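(* Let $p$ be a prime and let $G$ be a $p$-group of maximal class of order $p^m$ (so $m\ge 4$ and $G$ has nilpotency class $m-1$) with positive degree of commutativity. (1) If $G$ possesses an abelian maximal subgroup, then $$A_G(t)=\frac{1}{p^m}\left( \frac{p}{1-p^mt}+\frac{p^m-p^{m-1}}{1-p^{2}t}+\frac{p^{m-1}-p}{1-p^{m-1}t} \right).$$ (2) If $[P_1, P_3]= 1$ and $G$ possesses no abelian maximal subgroup, then $$A_G(t)=\frac{1}{p^m}\left( \frac{p}{1-p^mt}+\frac{p^m-p^{m-1}}{1-p^{2}t}+\frac{p^{m-1}-p^{m-3}}{1-p^{m-2}t}+ \frac{p^{m-3}-p}{1-p^{m-1}t}\right).$$
   Context: For a finite group $G$ and $n\ge 0$, $\alpha_{G,n}$ denotes the number of orbits of $G$ acting on $G^n$ by simultaneous conjugation $g\cdot(x_1,\dots,x_n)=(gx_1g^{-1},\dots,gx_ng^{-1})$, with $\alpha_{G,0}=1$, and $A_G(t)=\sum_{n\ge 0}\alpha_{G,n}t^n$ (a formal power series, which is a rational function of $t$). A group of order $p^m$ with $m\ge 4$ is of maximal class if it has nilpotency class $m-1$. Let $G$ be such a group, and let $\gamma_i(G)$ be the $i$th term of its lower central series ($\gamma_1(G)=G$). For $2\le i\le m-2$, the 2-step centralizer $K_i$ is the centralizer in $G$ of $\gamma_i(G)/\gamma_{i+2}(G)$, i.e. $K_i=\{g\in G : [g,x]\in\gamma_{i+2}(G)\text{ for all }x\in\gamma_i(G)\}$. Define $P_0=G$, $P_1=K_2$, $P_i=\gamma_i(G)$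 for $2\le i\le m$, and $P_i=1$ for $i\ge m$. The degree of commutativity $l=l(G)$ is the maximum integer such that $[P_i,P_j]\le P_{i+j+l}$ for all $i,j\ge 1$ if $P_1$ is not abelian, and $l=m-3$ if $P_1$ is abelian. *)

theory Defs
  imports "HOL-Algebra.Algebra" "HOL-Computational_Algebra.Formal_Power_Series"
begin

definition simult_conj ::
    "('a, 'b) monoid_scheme \<Rightarrow> nat \<Rightarrow> 'a \<Rightarrow> 'a list \<Rightarrow> 'a list" where
  "simult_conj G n g =
     (\<lambda>xs \<in> {xs. set xs \<subseteq> carrier G \<and> length xs = n}.
        map (\<lambda>x. g \<otimes>\<^bsub>G\<^esub> x \<otimes>\<^bsub>G\<^esub> inv\<^bsub>G\<^esub> g) xs)"

text \<open>\<open>G ^ n\<close> is the set of lists of length \<open>n\<close> over \<open>carrier G\<close>.\<close>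

definition num_conj_orbits :: "('a, 'b) monoid_scheme \<Rightarrow> nat \<Rightarrow> nat" where
  "num_conj_orbits G n =
     card (orbits G {xs. set xs \<subseteq> carrier G \<and> length xs = n} (simult_conj G n))"

definition conj_orbit_series :: "('a, 'b) monoid_scheme \<Rightarrow> rat fps" where
  "conj_orbit_series G = Abs_fps (\<lambda>n. of_nat (num_conj_orbits G n))"

definition commutator :: "('a, 'b) monoid_scheme \<Rightarrow> 'a \<Rightarrow> 'a \<Rightarrow> 'a" where
  "commutator G x y = x \<otimes>\<^bsub>G\<^esub> y \<otimes>\<^bsub>G\<^esub> inv\<^bsub>G\<^esub> x \<otimes>\<^bsub>G\<^esub> inv\<^bsub>G\<^esub> y"

definition commutator_subgroup :: "('a, 'b) monoid_scheme \<Rightarrow> 'a set \<Rightarrow> 'a set \<Rightarrow> 'a set" where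
  "commutator_subgroup G H K = generate G {commutator G h k | h k. h \<in> H \<and> k \<in> K}"

text \<open>The lower central series is indexed from \<open>1\<close>; the value at \<open>0\<close> is a dummy.\<close>

fun lower_central :: "('a, 'b) monoid_scheme \<Rightarrow> nat \<Rightarrow> 'a set" where
  "lower_central G 0 = carrier G"
| "lower_central G (Suc 0) = carrier G"
| "lower_central G (Suc (Suc n)) =
     commutator_subgroup G (lower_central G (Suc n)) (carrier G)"

definition nilpotent_group :: "('a, 'b) monoid_scheme \<Rightarrow> bool" where
  "nilpotent_group G \<longleftrightarrow> group G \<and> (\<exists>c. lower_central G (c + 1) = {\<one>\<^bsub>G\<^esub>})"

definition nilpotency_class :: "('a, 'b) monoid_scheme \<Rightarrow> nat" where
  "nilpotency_class G = (LEAST c. lower_central G (c + 1) = {\<one>\<^bsub>G\<^esub>})"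

definition maximal_class_group :: "('a, 'b) monoid_scheme \<Rightarrow> nat \<Rightarrow> nat \<Rightarrow> bool" where
  "maximal_class_group G p m \<longleftrightarrow>
     group G \<and> Factorial_Ring.prime p \<and> order G = p ^ m \<and> 4 \<le> m \<and>
     nilpotent_group G \<and> nilpotency_class G = m - 1"

definition two_step_centralizer :: "('a, 'b) monoid_scheme \<Rightarrow> nat \<Rightarrow> 'a set" where
  "two_step_centralizer G i =
     {g \<in> carrier G. \<forall>x \<in> lower_central G i. commutator G g x \<in> lower_central G (i + 2)}"

definition P_series :: "('a, 'b) monoid_scheme \<Rightarrow> nat \<Rightarrow> nat \<Rightarrow> 'a set" where
  "P_series G m i =
     (if i = 0 then carrier G
      else if i = 1 then two_step_centralizer G 2
      else if i < m then lower_central G i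
      else {\<one>\<^bsub>G\<^esub>})"

definition commutative_subgroup :: "'a set \<Rightarrow> ('a, 'b) monoid_scheme \<Rightarrow> bool" where
  "commutative_subgroup H G \<longleftrightarrow> subgroup H G \<and> comm_group (G\<lparr>carrier := H\<rparr>)"

definition maximal_subgroup :: "'a set \<Rightarrow> ('a, 'b) monoid_scheme \<Rightarrow> bool" where
  "maximal_subgroup H G \<longleftrightarrow>
     subgroup H G \<and> H \<noteq> carrier G \<and>
     (\<forall>K. subgroup K G \<and> H \<subseteq> K \<longrightarrow> K = H \<or> K = carrier G)"

text \<open>
  The maximum is taken over natural numbers rather than integers. In a group of maximal class
  \<open>l = 0\<close> always satisfies the condition, so both maxima agree, and no convention is needed for
  terms of the series at negative indices. If \<open>P_1\<close> is not abelian then \<open>[P_1, P_1] \<noteq> 1\<close>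
  forces \<open>l \<le> m - 3\<close>, so the maximum exists.
\<close>

definition degree_of_commutativity :: "('a, 'b) monoid_scheme \<Rightarrow> nat \<Rightarrow> nat" where
  "degree_of_commutativity G m =
     (if commutative_subgroup (P_series G m 1) G then m - 3
      else (GREATEST l. \<forall>i\<ge>1. \<forall>j\<ge>1.
              commutator_subgroup G (P_series G m i) (P_series G m j)
                \<subseteq> P_series G m (i + j + l)))"

end

theory Submission
  imports Defs
begin

text \<open>
  By Burnside's lemma, \<open>A_G(t) = 1/|G| \<Sum>\<^sub>g 1/(1 - |C(g)| t)\<close>, so only the orders of the
  centralizers matter. As the degree of commutativity is positive, \<open>[P 1, P i] \<le> P (i + 2)\<close>; hence
  for \<open>s\<close> outside the maximal subgroup \<open>P 1\<close> the map \<open>x \<mapsto> [s, x]\<close> sends \<open>P i - P (i + 1)\<close> into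
  \<open>P (i + 1) - P (i + 2)\<close>. Therefore \<open>C(s)\<close> meets \<open>P 1\<close> in \<open>P (m - 1)\<close>, the center, of order \<open>p\<close>,
  and \<open>|C(s)| = p\<^sup>2\<close>. A noncentral \<open>x\<close> in \<open>P 1\<close> has its centralizer inside \<open>P 1\<close>: it is all of \<open>P 1\<close>
  when \<open>x\<close> commutes with \<open>P 1\<close>; otherwise, if \<open>[P 1, P 3] = 1\<close>, it lies strictly between \<open>P 3\<close>
  and \<open>P 1\<close>. An abelian maximal subgroup can only be \<open>P 1\<close>.
\<close>

section \<open>Geometric power series, and preimages of subgroups\<close>

lemma fps_geometric:
  "1 / (1 - of_nat c * fps_X) = Abs_fps (\<lambda>n. of_nat c ^ n :: 'a :: field_char_0)"
proof -
  have c: "(of_nat c :: 'a fps) = fps_const (of_nat c)" by (simp add: fps_of_nat)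
  have "Abs_fps (\<lambda>n. of_nat c ^ n :: 'a) * (1 - of_nat c * fps_X) = 1"
  proof (rule fps_ext)
    fix n show "fps_nth (Abs_fps (\<lambda>n. of_nat c ^ n :: 'a) * (1 - of_nat c * fps_X)) n = fps_nth 1 n"
      unfolding c by (cases n) (simp_all add: algebra_simps)
  qed
  moreover have "fps_nth (1 - of_nat c * fps_X) 0 \<noteq> (0 :: 'a)" by simp
  ultimately show ?thesis
    by (metis fps_divide_unit fps_inverse_unique mult.commute mult_1)
qed

lemma fps_eq_divide_of_nat:
  assumes "of_nat k * a = (b :: 'a :: field_char_0 fps)" "k \<noteq> 0"
  shows "a = 1 / of_nat k * b"
proof -
  have k: "fps_nth (of_nat k :: 'a fps) 0 \<noteq> 0" using assms(2) by (simp flip: fps_of_nat)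
  then have "inverse (of_nat k) * of_nat k = (1 :: 'a fps)" by (rule inverse_mult_eq_1)
  then show ?thesis using k assms(1) by (metis fps_divide_unit mult.assoc mult_1)
qed

lemma (in group_hom) subgroup_vimage:
  assumes "subgroup S H"
  shows "subgroup {g \<in> carrier G. h g \<in> S} G"
proof (rule G.subgroupI)
  show "{g \<in> carrier G. h g \<in> S} \<noteq> {}"
    using subgroup.one_closed[OF assms] G.one_closed hom_one by auto
qed (use assms in \<open>auto intro: subgroup.m_inv_closed subgroup.m_closed\<close>)

subsection \<open>Commutators modulo a normal subgroup\<close>

context group
begin

lemma inv_mult_cancel_left:
  "x \<in> carrier G \<Longrightarrow> y \<in> carrier G \<Longrightarrow> inv x \<otimes> (x \<otimes> y) = y"
  by (simp flip: m_assoc)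

lemma commutator_closed [simp]:
  "x \<in> carrier G \<Longrightarrow> y \<in> carrier G \<Longrightarrow> commutator G x y \<in> carrier G"
  by (simp add: commutator_def)

lemma inv_commutator:
  "x \<in> carrier G \<Longrightarrow> y \<in> carrier G \<Longrightarrow> inv (commutator G x y) = commutator G y x"
  by (simp add: commutator_def inv_mult_group m_assoc)

lemma commutator_eq_mult_inv:
  "x \<in> carrier G \<Longrightarrow> y \<in> carrier G \<Longrightarrow> commutator G x y = (x \<otimes> y) \<otimes> inv (y \<otimes> x)"
  by (simp add: commutator_def inv_mult_group m_assoc)

lemma commutator_eq_one_iff:
  "x \<in> carrier G \<Longrightarrow> y \<in> carrier G \<Longrightarrow> commutator G x y = \<one> \<longleftrightarrow> x \<otimes> y = y \<otimes> x"
  by (metis commutator_eq_mult_inv m_closed inv_closed inv_equality inv_inv r_inv)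

lemma commutator_mem_sym:
  assumes "subgroup N G" "x \<in> carrier G" "y \<in> carrier G" "commutator G x y \<in> N"
  shows "commutator G y x \<in> N"
  using assms inv_commutator subgroup.m_inv_closed by metis

lemma conj_commutator:
  assumes "g \<in> carrier G" "x \<in> carrier G" "y \<in> carrier G"
  shows "g \<otimes> commutator G x y \<otimes> inv g
           = commutator G (g \<otimes> x \<otimes> inv g) (g \<otimes> y \<otimes> inv g)"
  using assms by (simp add: commutator_def inv_mult_group m_assoc inv_mult_cancel_left)

text \<open>As [x, y] = (xy)(yx)^-1, congruences of commutators modulo \<open>N\<close> become
  commuting relations between cosets.\<close>

lemma commutator_mem_iff_rcos:
  assumes "N \<lhd> G" "x \<in> carrier G" "y \<in> carrier G"
  shows "commutator G x y \<in> N \<longleftrightarrow> N #> (x \<otimes> y) = N #> (y \<otimes> x)"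
proof -
  have N: "subgroup N G" using assms normal_imp_subgroup by blast
  have "commutator G x y \<in> N \<longleftrightarrow> x \<otimes> y \<in> N #> (y \<otimes> x)"
    using assms N subgroup.rcos_module[OF N is_group, of "y \<otimes> x" "x \<otimes> y"]
    by (simp add: commutator_eq_mult_inv)
  also have "\<dots> \<longleftrightarrow> N #> (x \<otimes> y) = N #> (y \<otimes> x)"
    using assms N by (metis m_closed rcos_self repr_independence)
  finally show ?thesis .
qed

lemma commutator_mem_iff_FactGroup:
  assumes "N \<lhd> G" "x \<in> carrier G" "y \<in> carrier G"
  shows "commutator G x y \<in> N \<longleftrightarrow>
    (N #> x) \<otimes>\<^bsub>G Mod N\<^esub> (N #> y) = (N #> y) \<otimes>\<^bsub>G Mod N\<^esub> (N #> x)"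
  using assms by (simp add: commutator_mem_iff_rcos FactGroup_def normal.rcos_sum)

text \<open>\<open>mod_centralizer N x\<close> is the preimage of the centralizer of the coset of \<open>x\<close>
  in \<open>G / N\<close>.\<close>

definition mod_centralizer :: "'a set \<Rightarrow> 'a \<Rightarrow> 'a set" where
  "mod_centralizer N x = {g \<in> carrier G. commutator G g x \<in> N}"

lemma mem_mod_centralizer_sym:
  assumes "subgroup N G" "x \<in> carrier G" "y \<in> carrier G"
  shows "x \<in> mod_centralizer N y \<longleftrightarrow> y \<in> mod_centralizer N x"
  using assms commutator_mem_sym unfolding mod_centralizer_def by blast

lemma self_mem_mod_centralizer:
  assumes "subgroup N G" "x \<in> carrier G"
  shows "x \<in> mod_centralizer N x"
  using assms subgroup.one_closed
  by (simp add: mod_centralizer_def commutator_eq_mult_inv)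

lemma commutes_inv:
  assumes "a \<in> carrier G" "x \<in> carrier G" "a \<otimes> x = x \<otimes> a"
  shows "inv a \<otimes> x = x \<otimes> inv a"
proof -
  have "inv a \<otimes> x = inv a \<otimes> (x \<otimes> a) \<otimes> inv a"
    using assms(1,2) by (simp add: m_assoc)
  also have "\<dots> = inv a \<otimes> (a \<otimes> x) \<otimes> inv a"
    by (simp only: assms(3))
  also have "\<dots> = x \<otimes> inv a"
    using assms(1,2) by (simp flip: m_assoc)
  finally show ?thesis .
qed

lemma subgroup_commuting:
  assumes "x \<in> carrier G"
  shows "subgroup {g \<in> carrier G. g \<otimes> x = x \<otimes> g} G"
proof (rule subgroupI)
  fix a b
  assume "a \<in> {g \<in> carrier G. g \<otimes> x = x \<otimes> g}" "b \<in> {g \<in> carrier G. g \<otimes> x = x \<otimes> g}"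
  then have ab: "a \<in> carrier G" "b \<in> carrier G" "a \<otimes> x = x \<otimes> a" "b \<otimes> x = x \<otimes> b"
    by auto
  have "a \<otimes> b \<otimes> x = a \<otimes> (x \<otimes> b)" using ab(1,2) assms by (simp add: m_assoc ab(4))
  also have "\<dots> = x \<otimes> (a \<otimes> b)" using ab(1,2) assms by (simp add: ab(3) flip: m_assoc)
  finally show "a \<otimes> b \<in> {g \<in> carrier G. g \<otimes> x = x \<otimes> g}" using ab by simp
qed (use assms commutes_inv in auto)

text \<open>Being a subgroup is what later allows commutator conditions to be checked on generators;
  it follows by pulling back a centralizer along the quotient map.\<close>

lemma subgroup_mod_centralizer:
  assumes N: "N \<lhd> G" and x: "x \<in> carrier G"
  shows "subgroup (mod_centralizer N x) G"
proof -
  interpret Q: group "G Mod N" using N by (rule normal.factorgroup_is_group)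
  interpret h: group_hom G "G Mod N" "\<lambda>a. N #> a"
    using N normal.r_coset_hom_Mod[OF N]
    by (intro group_hom.intro group_hom_axioms.intro is_group Q.is_group)
  have "mod_centralizer N x
    = {g \<in> carrier G. N #> g \<in>
        {h \<in> carrier (G Mod N). h \<otimes>\<^bsub>G Mod N\<^esub> (N #> x) = (N #> x) \<otimes>\<^bsub>G Mod N\<^esub> h}}"
    using x h.hom_closed unfolding mod_centralizer_def
    by (auto simp only: commutator_mem_iff_FactGroup[OF N _ x])
  then show ?thesis
    using h.subgroup_vimage[OF Q.subgroup_commuting[OF h.hom_closed[OF x]]]
    by simp
qed

lemma subset_mod_centralizer:
  assumes N: "N \<lhd> G" and x: "x \<in> carrier G"
  shows "N \<subseteq> mod_centralizer N x"
proof
  fix n assume n: "n \<in> N"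
  have sN: "subgroup N G" using N by (rule normal_imp_subgroup)
  have nG: "n \<in> carrier G" using subgroup.mem_carrier[OF sN n] .
  have "n \<otimes> (x \<otimes> inv n \<otimes> inv x) \<in> N"
    using subgroup.m_closed[OF sN n] normal.inv_op_closed2[OF N x] subgroup.m_inv_closed[OF sN n]
    by blast
  then show "n \<in> mod_centralizer N x"
    using nG x by (simp add: mod_centralizer_def commutator_def m_assoc)
qed

text \<open>Here \<open>d\<close> and \<open>e\<close> play the commutators [a, b] and [g, b].
  Moving \<open>b\<close> left past \<open>a g\<close> or past \<open>g a\<close> leaves the same
  prefix e d b, so (ga)^-1(ag) commutes with \<open>b\<close>.\<close>

lemma commutes_conj_action:
  assumes c: "a \<in> carrier G" "b \<in> carrier G" "g \<in> carrier G" "d \<in> carrier G" "e \<in> carrier G"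
    and ab: "a \<otimes> b = d \<otimes> (b \<otimes> a)" and gb: "g \<otimes> b = e \<otimes> (b \<otimes> g)"
    and dg: "d \<otimes> g = g \<otimes> d" and ea: "e \<otimes> a = a \<otimes> e" and ed: "e \<otimes> d = d \<otimes> e"
  shows "inv (g \<otimes> a) \<otimes> (a \<otimes> g) \<otimes> b = b \<otimes> (inv (g \<otimes> a) \<otimes> (a \<otimes> g))"
proof -
  have "a \<otimes> g \<otimes> b = a \<otimes> (e \<otimes> (b \<otimes> g))" using c by (simp add: m_assoc gb)
  also have "\<dots> = e \<otimes> (a \<otimes> b) \<otimes> g" using c by (simp flip: m_assoc add: ea)
  also have "\<dots> = e \<otimes> (d \<otimes> (b \<otimes> a)) \<otimes> g" by (simp only: ab)
  also have "\<dots> = e \<otimes> d \<otimes> b \<otimes> (a \<otimes> g)" using c by (simp add: m_assoc)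
  finally have 1: "a \<otimes> g \<otimes> b = e \<otimes> d \<otimes> b \<otimes> (a \<otimes> g)" .
  have "g \<otimes> a \<otimes> b = g \<otimes> (d \<otimes> (b \<otimes> a))" using c by (simp add: m_assoc ab)
  also have "\<dots> = d \<otimes> (g \<otimes> b) \<otimes> a" using c by (simp flip: m_assoc add: dg)
  also have "\<dots> = d \<otimes> (e \<otimes> (b \<otimes> g)) \<otimes> a" by (simp only: gb)
  also have "\<dots> = e \<otimes> d \<otimes> b \<otimes> (g \<otimes> a)" using c by (simp flip: m_assoc add: ed)
  finally have 2: "g \<otimes> a \<otimes> b = e \<otimes> d \<otimes> b \<otimes> (g \<otimes> a)" .
  have "b = inv (g \<otimes> a) \<otimes> (g \<otimes> a \<otimes> b)" using c by (simp add: inv_mult_cancel_left)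
  then have 3: "inv (g \<otimes> a) \<otimes> (e \<otimes> d \<otimes> b) = b \<otimes> inv (g \<otimes> a)"
    using c unfolding 2 by (metis inv_solve_right m_assoc m_closed inv_closed)
  have "inv (g \<otimes> a) \<otimes> (a \<otimes> g) \<otimes> b = inv (g \<otimes> a) \<otimes> (e \<otimes> d \<otimes> b) \<otimes> (a \<otimes> g)"
    using c 1 by (simp add: m_assoc)
  also have "\<dots> = b \<otimes> (inv (g \<otimes> a) \<otimes> (a \<otimes> g))"
    using c 3 by (simp add: m_assoc)
  finally show ?thesis .
qed

text \<open>A form of the three subgroups lemma: modulo \<open>N\<close>, the elements \<open>a g\<close> and \<open>g a\<close>
  conjugate \<open>b\<close> to the same element.\<close>

lemma commutator_commutator_mem:
  assumes N: "N \<lhd> G" and c: "a \<in> carrier G" "g \<in> carrier G" "b \<in> carrier G"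
    and 1: "commutator G (commutator G a b) g \<in> N"
    and 2: "commutator G (commutator G g b) a \<in> N"
    and 3: "commutator G (commutator G g b) (commutator G a b) \<in> N"
  shows "commutator G (commutator G (inv a) (inv g)) b \<in> N"
proof -
  interpret Q: group "G Mod N" using N by (rule normal.factorgroup_is_group)
  interpret h: group_hom G "G Mod N" "\<lambda>a. N #> a"
    using N normal.r_coset_hom_Mod[OF N]
    by (intro group_hom.intro group_hom_axioms.intro is_group Q.is_group)
  have ab: "a \<otimes> b = commutator G a b \<otimes> (b \<otimes> a)"
    and gb: "g \<otimes> b = commutator G g b \<otimes> (b \<otimes> g)"
    using c by (simp_all add: commutator_def m_assoc inv_mult_cancel_left)
  \<comment> \<open>With [x, y] = x y x^-1 y^-1 this is exactly the quotient treated in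
    \<open>commutes_conj_action\<close>.\<close>
  have cg: "commutator G (inv a) (inv g) = inv (g \<otimes> a) \<otimes> (a \<otimes> g)"
    using c by (simp add: commutator_def inv_mult_group m_assoc)
  have 4: "(N #> commutator G (inv a) (inv g))
      = inv\<^bsub>G Mod N\<^esub> ((N #> g) \<otimes>\<^bsub>G Mod N\<^esub> (N #> a)) \<otimes>\<^bsub>G Mod N\<^esub> ((N #> a) \<otimes>\<^bsub>G Mod N\<^esub> (N #> g))"
    unfolding cg using c by (simp only: h.hom_inv h.hom_mult inv_closed m_closed)
  have "(N #> commutator G (inv a) (inv g)) \<otimes>\<^bsub>G Mod N\<^esub> (N #> b)
      = (N #> b) \<otimes>\<^bsub>G Mod N\<^esub> (N #> commutator G (inv a) (inv g))"
    unfolding 4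
  proof (rule Q.commutes_conj_action)
    show "(N #> a) \<otimes>\<^bsub>G Mod N\<^esub> (N #> b)
      = (N #> commutator G a b) \<otimes>\<^bsub>G Mod N\<^esub> ((N #> b) \<otimes>\<^bsub>G Mod N\<^esub> (N #> a))"
      using arg_cong[OF ab, of "\<lambda>x. N #> x"] c
      by (simp only: h.hom_mult m_closed commutator_closed)
    show "(N #> g) \<otimes>\<^bsub>G Mod N\<^esub> (N #> b)
      = (N #> commutator G g b) \<otimes>\<^bsub>G Mod N\<^esub> ((N #> b) \<otimes>\<^bsub>G Mod N\<^esub> (N #> g))"
      using arg_cong[OF gb, of "\<lambda>x. N #> x"] c
      by (simp only: h.hom_mult m_closed commutator_closed)
  qed (use c 1 2 3 N in \<open>simp_all only: commutator_mem_iff_FactGroup commutator_closed h.hom_closed\<close>)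
  then show ?thesis
    using c N by (simp add: commutator_mem_iff_FactGroup del: mult_FactGroup)
qed

subsection \<open>The lower central series\<close>

lemma lower_central_Suc:
  "1 \<le> i \<Longrightarrow> lower_central G (Suc i) = commutator_subgroup G (lower_central G i) (carrier G)"
  by (cases i) auto

text \<open>Conjugates of commutators are commutators of conjugates, so each generating set is
  stable under conjugation.\<close>

lemma normal_lower_central: "lower_central G i \<lhd> G"
proof (induction i)
  case 0
  show ?case by (simp add: normal_self)
next
  case (Suc i)
  show ?case
  proof (cases i)
    case 0
    then show ?thesis by (simp add: normal_self)
  next
    case (Suc n)
    have sub: "lower_central G i \<subseteq> carrier G"
      using Suc.IH normal_imp_subgroup subgroup.subset by blast
    have "generate G {commutator G h k | h k. h \<in> lower_central G i \<and> k \<in> carrier G} \<lhd> G"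
    proof (rule normal_generateI)
      fix c g
      assume "c \<in> {commutator G h k | h k. h \<in> lower_central G i \<and> k \<in> carrier G}"
        and g: "g \<in> carrier G"
      then obtain h k where c: "c = commutator G h k" "h \<in> lower_central G i" "k \<in> carrier G"
        by blast
      then have "g \<otimes> c \<otimes> inv g = commutator G (g \<otimes> h \<otimes> inv g) (g \<otimes> k \<otimes> inv g)"
        using g sub conj_commutator by blast
      moreover have "g \<otimes> h \<otimes> inv g \<in> lower_central G i"
        using normal.inv_op_closed2[OF Suc.IH g c(2)] .
      moreover have "g \<otimes> k \<otimes> inv g \<in> carrier G" using g c by simp
      ultimately show "g \<otimes> c \<otimes> inv g
          \<in> {commutator G h k | h k. h \<in> lower_central G i \<and> k \<in> carrier G}"
        by blast
    qed (use sub in auto)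
    then show ?thesis
      using Suc by (simp add: commutator_subgroup_def)
  qed
qed

declare lower_central.simps(3) [simp del]

lemma subgroup_lower_central: "subgroup (lower_central G i) G"
  using normal_lower_central by (rule normal_imp_subgroup)

lemma mem_lower_central_carrier: "x \<in> lower_central G i \<Longrightarrow> x \<in> carrier G"
  using subgroup_lower_central subgroup.mem_carrier by metis

lemma commutator_mem_commutator_subgroup:
  "h \<in> H \<Longrightarrow> k \<in> K \<Longrightarrow> commutator G h k \<in> commutator_subgroup G H K"
  unfolding commutator_subgroup_def by (blast intro: generate.incl)

lemma commutator_subgroup_subset:
  assumes "subgroup N G" "\<And>h k. h \<in> H \<Longrightarrow> k \<in> K \<Longrightarrow> commutator G h k \<in> N"
  shows "commutator_subgroup G H K \<subseteq> N"
  unfolding commutator_subgroup_def using assms by (intro generate_subgroup_incl) auto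

lemma commutator_mem_lower_central:
  "1 \<le> i \<Longrightarrow> x \<in> lower_central G i \<Longrightarrow> g \<in> carrier G
    \<Longrightarrow> commutator G x g \<in> lower_central G (Suc i)"
  by (simp add: lower_central_Suc commutator_mem_commutator_subgroup)

lemma commutator_mem_lower_central':
  "1 \<le> i \<Longrightarrow> x \<in> lower_central G i \<Longrightarrow> g \<in> carrier G
    \<Longrightarrow> commutator G g x \<in> lower_central G (Suc i)"
  by (meson commutator_mem_lower_central commutator_mem_sym mem_lower_central_carrier
      subgroup_lower_central)

lemma lower_central_Suc_subset_iff:
  assumes "1 \<le> i" "subgroup N G"
  shows "lower_central G (Suc i) \<subseteq> N \<longleftrightarrow>
    (\<forall>x \<in> lower_central G i. \<forall>g \<in> carrier G. commutator G g x \<in> N)"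
proof
  assume "lower_central G (Suc i) \<subseteq> N"
  then show "\<forall>x \<in> lower_central G i. \<forall>g \<in> carrier G. commutator G g x \<in> N"
    using commutator_mem_lower_central'[OF assms(1)] by blast
next
  assume r: "\<forall>x \<in> lower_central G i. \<forall>g \<in> carrier G. commutator G g x \<in> N"
  show "lower_central G (Suc i) \<subseteq> N"
    unfolding lower_central_Suc[OF assms(1)]
    using r assms(2) by (intro commutator_subgroup_subset)
      (auto intro: commutator_mem_sym mem_lower_central_carrier)
qed

lemma normal_commutator_mem:
  assumes "N \<lhd> G" "x \<in> N" "g \<in> carrier G"
  shows "commutator G g x \<in> N"
proof -
  have "subgroup N G" using assms normal_imp_subgroup by blast
  moreover have "x \<in> mod_centralizer N g"
    using subset_mod_centralizer assms by blast
  ultimately show ?thesis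
    using assms commutator_mem_sym unfolding mod_centralizer_def by blast
qed

lemma lower_central_Suc_subset: "lower_central G (Suc i) \<subseteq> lower_central G i"
proof (cases "i = 0")
  case False
  then show ?thesis
    using normal_commutator_mem[OF normal_lower_central]
    by (subst lower_central_Suc_subset_iff) (auto simp: subgroup_lower_central)
qed simp

lemma lower_central_antimono: "i \<le> j \<Longrightarrow> lower_central G j \<subseteq> lower_central G i"
  using lower_central_Suc_subset by (rule lift_Suc_antimono_le)

text \<open>Induction through the three subgroups lemma, applied to the generators [x, g] of the
  next term. The hypothesis is used at \<open>j\<close> and at \<open>j + 1\<close>, hence the
  generalization over \<open>j\<close>.\<close>

lemma lower_central_commutator:
  "1 \<le> i \<Longrightarrow> 1 \<le> j \<Longrightarrow> a \<in> lower_central G i \<Longrightarrow> b \<in> lower_central G j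
    \<Longrightarrow> commutator G a b \<in> lower_central G (i + j)"
proof (induction i arbitrary: j a b rule: nat_induct_at_least)
  case base
  then show ?case
    using commutator_mem_lower_central'[of j b a] by simp
next
  case (Suc i)
  let ?N = "lower_central G (Suc i + j)"
  have N: "?N \<lhd> G" and sN: "subgroup ?N G"
    by (rule normal_lower_central, rule subgroup_lower_central)
  have b: "b \<in> carrier G" using mem_lower_central_carrier[OF Suc.prems(3)] .
  have *: "commutator G (commutator G x g) b \<in> ?N"
    if x: "x \<in> lower_central G i" and g: "g \<in> carrier G" for x g
  proof -
    \<comment> \<open>\<open>commutator_commutator_mem\<close> concludes about a commutator of
      inverses, so it is fed the inverses of \<open>x\<close> and \<open>g\<close>.\<close>
    let ?x = "inv x" and ?g = "inv g"
    have x': "?x \<in> lower_central G i" "?x \<in> carrier G" "x \<in> carrier G"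
      using subgroup.m_inv_closed[OF subgroup_lower_central x] mem_lower_central_carrier[OF x]
      by simp_all
    have xb: "commutator G ?x b \<in> lower_central G (i + j)"
      using Suc.IH[OF Suc.prems(1) x'(1) Suc.prems(3)] .
    have gb: "commutator G ?g b \<in> lower_central G (Suc j)"
      using commutator_mem_lower_central'[OF Suc.prems(1,3)] g by simp
    have g': "?g \<in> carrier G" using g by simp
    have 1: "commutator G (commutator G ?x b) z \<in> ?N" if "z \<in> carrier G" for z
      using commutator_mem_lower_central[OF _ xb that] Suc.hyps by simp
    have "commutator G ?x (commutator G ?g b) \<in> ?N"
      using Suc.IH[OF _ x'(1) gb] by simp
    then have 2: "commutator G (commutator G ?g b) ?x \<in> ?N"
      by (rule commutator_mem_sym[OF sN x'(2) commutator_closed[OF g' b]])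
    have 3: "commutator G (commutator G ?g b) (commutator G ?x b) \<in> ?N"
      by (rule commutator_mem_sym[OF sN commutator_closed[OF x'(2) b] commutator_closed[OF g' b]
          1[OF commutator_closed[OF g' b]]])
    show ?thesis
      using commutator_commutator_mem[OF N x'(2) g' b 1[OF g'] 2 3] g x' by simp
  qed
  have "lower_central G (Suc i) \<subseteq> mod_centralizer ?N b"
    unfolding lower_central_Suc[OF Suc.hyps]
  proof (rule commutator_subgroup_subset[OF subgroup_mod_centralizer[OF N b]])
    fix x g assume x: "x \<in> lower_central G i" and g: "g \<in> carrier G"
    show "commutator G x g \<in> mod_centralizer ?N b"
      using *[OF x g] g mem_lower_central_carrier[OF x] by (simp add: mod_centralizer_def)
  qed
  then show ?case
    using Suc.prems unfolding mod_centralizer_def by blast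
qed

section \<open>Counting in subgroups\<close>

lemma card_subgroup_mult:
  assumes "subgroup H G" "subgroup K G" "H \<subseteq> K"
  shows "card (rcosets\<^bsub>G\<lparr>carrier := K\<rparr>\<^esub> H) * card H = card K"
proof -
  interpret K: group "G\<lparr>carrier := K\<rparr>"
    using assms(2) by (rule subgroup_imp_group)
  show ?thesis
    using K.lagrange[OF subgroup_incl[OF assms]] by (simp add: order_def)
qed

text \<open>Choose a representative of each fibre of \<open>f\<close>; pairing \<open>f a\<close>
  with the quotient of \<open>a\<close> by the representative of its fibre is injective into V x D.
  In use, \<open>f\<close> is a coset map or a commutator map.\<close>

lemma card_subgroup_le_fibres:
  assumes H: "subgroup H G" and V: "f ` H \<subseteq> V" "finite V" and D: "finite D"
    and fib: "\<And>a b. a \<in> H \<Longrightarrow> b \<in> H \<Longrightarrow> f a = f b \<Longrightarrow> a \<otimes> inv b \<in> D"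
  shows "card H \<le> card V * card D"
proof -
  define s where "s v = (SOME b. b \<in> H \<and> f b = v)" for v
  have s: "s (f a) \<in> H \<and> f (s (f a)) = f a" if "a \<in> H" for a
    unfolding s_def using that by (rule_tac someI[of _ a]) simp
  have HG: "a \<in> H \<Longrightarrow> a \<in> carrier G" for a using subgroup.mem_carrier[OF H] .
  have "inj_on (\<lambda>a. (f a, a \<otimes> inv (s (f a)))) H"
  proof (rule inj_onI)
    fix a b assume ab: "a \<in> H" "b \<in> H" "(f a, a \<otimes> inv (s (f a))) = (f b, b \<otimes> inv (s (f b)))"
    then have e: "f a = f b" "a \<otimes> inv (s (f a)) = b \<otimes> inv (s (f b))" by auto
    show "a = b" using e(2)[unfolded e(1)] HG ab(1,2) s[OF ab(2)] by simp
  qed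
  moreover have "(\<lambda>a. (f a, a \<otimes> inv (s (f a)))) ` H \<subseteq> V \<times> D"
  proof (rule image_subsetI)
    fix a assume a: "a \<in> H"
    show "(f a, a \<otimes> inv (s (f a))) \<in> V \<times> D"
      using fib[OF a, of "s (f a)"] s[OF a] V(1) a by auto
  qed
  ultimately have "card H \<le> card (V \<times> D)"
    using V(2) D by (intro card_inj_on_le) auto
  then show ?thesis by (simp add: card_cartesian_product)
qed

lemma card_subgroup_le_Int:
  assumes "subgroup H G" "subgroup K G" "finite (carrier G)"
  shows "card H \<le> card (rcosets K) * card (H \<inter> K)"
proof (rule card_subgroup_le_fibres[OF assms(1)])
  have HG: "a \<in> H \<Longrightarrow> a \<in> carrier G" for a using subgroup.mem_carrier[OF assms(1)] .
  show "(\<lambda>a. K #> a) ` H \<subseteq> rcosets K"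
    using HG by (auto simp: RCOSETS_def)
  show "finite (rcosets K)"
    using assms(3) by (auto simp: RCOSETS_def)
  show "finite (H \<inter> K)"
    using assms(3) subgroup.subset[OF assms(1)] finite_subset by blast
  fix a b assume ab: "a \<in> H" "b \<in> H" "K #> a = K #> b"
  then have "a \<in> K #> b" using rcos_self[OF HG assms(2)] by blast
  then have "a \<otimes> inv b \<in> K"
    using subgroup.rcos_module[OF assms(2) is_group] ab HG by blast
  then show "a \<otimes> inv b \<in> H \<inter> K"
    using ab subgroup.m_closed[OF assms(1)] subgroup.m_inv_closed[OF assms(1)] by blast
qed

lemma commutative_subgroup_iff:
  assumes "subgroup H G"
  shows "commutative_subgroup H G \<longleftrightarrow> (\<forall>x \<in> H. \<forall>y \<in> H. commutator G x y = \<one>)"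
proof -
  have HG: "a \<in> H \<Longrightarrow> a \<in> carrier G" for a using subgroup.mem_carrier[OF assms] .
  have "comm_group (G\<lparr>carrier := H\<rparr>) \<longleftrightarrow> (\<forall>x \<in> H. \<forall>y \<in> H. x \<otimes> y = y \<otimes> x)"
  proof
    assume "comm_group (G\<lparr>carrier := H\<rparr>)"
    from comm_monoid.m_comm[OF comm_group.axioms(1)[OF this]]
    show "\<forall>x \<in> H. \<forall>y \<in> H. x \<otimes> y = y \<otimes> x" by simp
  next
    assume "\<forall>x \<in> H. \<forall>y \<in> H. x \<otimes> y = y \<otimes> x"
    then show "comm_group (G\<lparr>carrier := H\<rparr>)"
      using subgroup_imp_group[OF assms] by (intro group.group_comm_groupI) auto
  qed
  then show ?thesis
    using assms HG by (auto simp: commutative_subgroup_def commutator_eq_one_iff)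
qed

subsection \<open>Orbits of simultaneous conjugation\<close>

lemma conj_eq_self_iff:
  assumes "g \<in> carrier G" "x \<in> carrier G"
  shows "g \<otimes> x \<otimes> inv g = x \<longleftrightarrow> x \<in> mod_centralizer {\<one>} g"
  using assms commutator_eq_one_iff[of x g] inv_solve_right'[of x "g \<otimes> x" g]
  by (auto simp: mod_centralizer_def)

lemma group_action_simult_conj:
  "group_action G {xs. set xs \<subseteq> carrier G \<and> length xs = n} (simult_conj G n)"
    (is "group_action G ?E _")
proof -
  have mem: "simult_conj G n g xs \<in> ?E" if "g \<in> carrier G" "xs \<in> ?E" for g xs
    using that by (auto simp: simult_conj_def)
  have comp: "simult_conj G n g (simult_conj G n h xs) = simult_conj G n (g \<otimes> h) xs"
    if "g \<in> carrier G" "h \<in> carrier G" "xs \<in> ?E" for g h xs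
    using that mem[OF that(2,3)]
    by (auto simp: simult_conj_def inv_mult_group m_assoc subset_iff)
  have one: "simult_conj G n \<one> xs = xs" if "xs \<in> ?E" for xs
    using that by (auto simp: simult_conj_def subset_iff intro: map_idI)
  have bij: "simult_conj G n g \<in> Bij ?E" if g: "g \<in> carrier G" for g
  proof -
    have "bij_betw (simult_conj G n g) ?E ?E"
    proof (rule bij_betw_byWitness[where f' = "simult_conj G n (inv g)"])
      show "\<forall>xs\<in>?E. simult_conj G n (inv g) (simult_conj G n g xs) = xs"
        using comp[OF inv_closed[OF g] g] one g by simp
      show "\<forall>xs\<in>?E. simult_conj G n g (simult_conj G n (inv g) xs) = xs"
        using comp[OF g inv_closed[OF g]] one g by simp
    qed (use mem g in blast)+
    \<comment> \<open>\<open>BijGroup\<close> consists of extensional maps, hence the restricted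
      lambda in \<open>simult_conj\<close>.\<close>
    moreover have "simult_conj G n g \<in> extensional ?E"
      unfolding simult_conj_def by (rule restrict_extensional)
    ultimately show ?thesis by (simp add: Bij_def)
  qed
  have "simult_conj G n \<in> hom G (BijGroup ?E)"
  proof (rule homI)
    fix g assume "g \<in> carrier G"
    then show "simult_conj G n g \<in> carrier (BijGroup ?E)"
      using bij by (simp add: BijGroup_def)
  next
    fix g h assume gh: "g \<in> carrier G" "h \<in> carrier G"
    have "simult_conj G n (g \<otimes> h) = compose ?E (simult_conj G n g) (simult_conj G n h)"
    proof (rule extensionalityI)
      show "simult_conj G n (g \<otimes> h) \<in> extensional ?E"
        unfolding simult_conj_def by (rule restrict_extensional)
      show "compose ?E (simult_conj G n g) (simult_conj G n h) \<in> extensional ?E"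
        by (rule compose_extensional)
      fix xs assume "xs \<in> ?E"
      then show "simult_conj G n (g \<otimes> h) xs = compose ?E (simult_conj G n g) (simult_conj G n h) xs"
        using comp[OF gh] by (simp add: compose_eq)
    qed
    then show "simult_conj G n (g \<otimes> h)
        = simult_conj G n g \<otimes>\<^bsub>BijGroup ?E\<^esub> simult_conj G n h"
      using bij gh by (simp add: BijGroup_def)
  qed
  then show ?thesis
    by (simp add: group_action_def group_hom_def group_hom_axioms_def is_group group_BijGroup)
qed

text \<open>Burnside's lemma: a tuple is fixed by \<open>g\<close> exactly when all its entries
  commute with \<open>g\<close>.\<close>

lemma num_conj_orbits_mult_order:
  assumes fin: "finite (carrier G)"
  shows "num_conj_orbits G n * order G = (\<Sum>g \<in> carrier G. card (mod_centralizer {\<one>} g) ^ n)"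
proof -
  let ?E = "{xs. set xs \<subseteq> carrier G \<and> length xs = n}"
  interpret A: group_action G ?E "simult_conj G n"
    by (rule group_action_simult_conj)
  have "card (invariants ?E (simult_conj G n) g) = card (mod_centralizer {\<one>} g) ^ n"
    if g: "g \<in> carrier G" for g
  proof -
    have "map (\<lambda>x. g \<otimes> x \<otimes> inv g) xs = xs \<longleftrightarrow> set xs \<subseteq> mod_centralizer {\<one>} g"
      if "set xs \<subseteq> carrier G" for xs
      using that conj_eq_self_iff[OF g] by (induction xs) auto
    then have "invariants ?E (simult_conj G n) g
        = {xs. set xs \<subseteq> mod_centralizer {\<one>} g \<and> length xs = n}"
      unfolding invariants_def simult_conj_def by (auto simp: mod_centralizer_def)
    moreover have "finite (mod_centralizer {\<one>} g)"
      using fin by (simp add: mod_centralizer_def)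
    ultimately show ?thesis by (simp add: card_lists_length_eq)
  qed
  then show ?thesis
    using A.burnside[OF fin finite_lists_length_eq[OF fin]] by (simp add: num_conj_orbits_def)
qed

text \<open>Summed over \<open>n\<close>, the powers of each centralizer order form a geometric
  series; coefficients are compared after clearing the denominator |G|.\<close>

lemma conj_orbit_series_eq_sum:
  assumes fin: "finite (carrier G)"
  shows "conj_orbit_series G = 1 / of_nat (order G) *
    (\<Sum>g \<in> carrier G. 1 / (1 - of_nat (card (mod_centralizer {\<one>} g)) * fps_X))"
proof -
  have "order G \<noteq> 0" using fin by (auto simp: order_def)
  have "of_nat (order G) * conj_orbit_series G
      = (\<Sum>g \<in> carrier G. 1 / (1 - of_nat (card (mod_centralizer {\<one>} g)) * fps_X))"
  proof (rule fps_ext)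
    fix n
    have "fps_nth (of_nat (order G) * conj_orbit_series G) n = of_nat (num_conj_orbits G n * order G)"
      unfolding conj_orbit_series_def fps_of_nat[symmetric] by simp
    also have "\<dots> = (\<Sum>g \<in> carrier G. of_nat (card (mod_centralizer {\<one>} g)) ^ n)"
      unfolding num_conj_orbits_mult_order[OF fin] by simp
    finally show "fps_nth (of_nat (order G) * conj_orbit_series G) n
      = fps_nth (\<Sum>g \<in> carrier G. 1 / (1 - of_nat (card (mod_centralizer {\<one>} g)) * fps_X)) n"
      by (simp add: fps_geometric fps_sum_nth)
  qed
  then show ?thesis
    using \<open>order G \<noteq> 0\<close> by (rule fps_eq_divide_of_nat)
qed

end

subsection \<open>Groups of maximal class\<close>

locale finite_p_group = group +
  fixes p m :: nat
  assumes prime_p: "Factorial_Ring.prime p" and order_p: "order G = p ^ m"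
begin

lemma p_gt_1: "1 < p"
  using prime_p by (rule prime_gt_1_nat)

lemma finite_G: "finite (carrier G)"
  using order_p p_gt_1 by (metis card.infinite not_one_less_zero order_def power_eq_0_iff)

lemma finite_subgroup: "subgroup H G \<Longrightarrow> finite H"
  using finite_G subgroup.subset finite_subset by blast

text \<open>The index divides p^m and exceeds 1, so it is a positive power of p.\<close>

lemma card_psubset_subgroup:
  assumes "subgroup H G" "subgroup K G" "H \<subset> K"
  shows "p * card H \<le> card K"
proof -
  let ?q = "card (rcosets\<^bsub>G\<lparr>carrier := K\<rparr>\<^esub> H)"
  have eq: "?q * card H = card K"
    using card_subgroup_mult assms by blast
  moreover have "card K dvd p ^ m"
    using lagrange[OF assms(2)] order_p by (metis dvd_triv_right)
  ultimately have "?q dvd p ^ m"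
    by (metis dvd_mult_left)
  then obtain k where k: "?q = p ^ k"
    using divides_primepow_nat[OF prime_p] by blast
  have "card H < card K"
    using assms finite_subgroup psubset_card_mono by blast
  then have "k \<noteq> 0" using eq k by (intro notI) simp
  then have "p \<le> ?q" using k p_gt_1 by (simp add: self_le_power)
  then show ?thesis using eq by (metis mult_le_mono1)
qed

text \<open>\<open>K \<inter> L\<close> contains \<open>H\<close> properly, hence has at least p |H|
  elements, as many as \<open>K\<close>.\<close>

lemma subset_subgroup_of_index_p:
  assumes H: "subgroup H G" and K: "subgroup K G" and L: "subgroup L G"
    and "card K \<le> p * card H" "H \<subseteq> K" "H \<subseteq> L" "x \<in> K" "x \<in> L" "x \<notin> H"
  shows "K \<subseteq> L"
proof -
  have KL: "subgroup (K \<inter> L) G" using K L by (rule subgroups_Inter_pair)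
  have "H \<subset> K \<inter> L" using assms(5-) by blast
  then have "card K \<le> card (K \<inter> L)"
    using card_psubset_subgroup[OF H KL] assms(4) by linarith
  then show ?thesis
    using card_seteq[OF finite_subgroup[OF K], of "K \<inter> L"] by blast
qed

end

locale maximal_class = finite_p_group +
  assumes max_class: "maximal_class_group G p m"
begin

abbreviation "\<gamma> \<equiv> lower_central G"
abbreviation "P \<equiv> P_series G m"

section \<open>Orders of the lower central terms\<close>

lemma m_ge_4: "4 \<le> m"
  using max_class by (simp add: maximal_class_group_def)

lemma class_G: "nilpotency_class G = m - 1"
  using max_class by (simp add: maximal_class_group_def)

lemma gamma_m: "\<gamma> m = {\<one>}"
proof -
  have "\<exists>c. \<gamma> (c + 1) = {\<one>}"
    using max_class by (simp add: maximal_class_group_def nilpotent_group_def)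
  then have "\<gamma> (nilpotency_class G + 1) = {\<one>}"
    unfolding nilpotency_class_def by (rule LeastI_ex)
  then show ?thesis using class_G m_ge_4 by simp
qed

lemma gamma_nontrivial:
  assumes "1 \<le> i" "i < m"
  shows "\<gamma> i \<noteq> {\<one>}"
proof
  assume "\<gamma> i = {\<one>}"
  then have "\<gamma> ((i - 1) + 1) = {\<one>}" using assms by simp
  then have "nilpotency_class G \<le> i - 1"
    unfolding nilpotency_class_def by (rule Least_le)
  then show False using class_G assms by simp
qed

text \<open>If two consecutive terms agreed, the series would be constant from there on and could
  not become trivial at index \<open>m\<close>.\<close>

lemma gamma_Suc_psubset:
  assumes "1 \<le> i" "i < m"
  shows "\<gamma> (Suc i) \<subset> \<gamma> i"
proof (rule psubsetI[OF lower_central_Suc_subset], rule notI)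
  assume eq: "\<gamma> (Suc i) = \<gamma> i"
  have "\<gamma> (i + k) = \<gamma> i" for k
  proof (induction k)
    case (Suc k)
    then show ?case
      using lower_central_Suc[of "i + k"] lower_central_Suc[of i] assms eq by simp
  qed simp
  from this[of "m - i"] show False
    using gamma_m gamma_nontrivial[OF assms] assms by simp
qed

lemma not_gamma_Suc_superset:
  assumes "1 \<le> i" "i < m"
  shows "\<not> \<gamma> i \<subseteq> \<gamma> (Suc i)"
  using gamma_Suc_psubset[OF assms] by blast

text \<open>Each strict inclusion contributes a factor of at least p, starting from the trivial term
  at index \<open>m\<close>.\<close>

lemma card_gamma_ge: "1 \<le> i \<Longrightarrow> i \<le> m \<Longrightarrow> p ^ (m - i) \<le> card (\<gamma> i)"
proof (induction "m - i" arbitrary: i)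
  case 0
  then show ?case using gamma_m by simp
next
  case (Suc k)
  then have "p ^ (m - Suc i) \<le> card (\<gamma> (Suc i))" by simp
  moreover have "p * card (\<gamma> (Suc i)) \<le> card (\<gamma> i)"
    using card_psubset_subgroup[OF subgroup_lower_central subgroup_lower_central gamma_Suc_psubset]
      Suc by simp
  moreover have "p ^ (m - i) = p * p ^ (m - Suc i)"
    using Suc by (simp add: Suc_diff_Suc flip: power_Suc)
  ultimately show ?case
    by (metis le_trans mult_le_mono2)
qed

text \<open>The elements commuting with \<open>g\<close> modulo \<open>N\<close> form a subgroup;
  once it contains \<open>H\<close> and one element of \<open>K\<close> outside \<open>H\<close>,
  the index bound makes it contain \<open>K\<close>.\<close>

lemma commutator_mod_generation:
  assumes N: "N \<lhd> G" and H: "subgroup H G" and K: "subgroup K G"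
    and idx: "card K \<le> p * card H" "H \<subseteq> K"
    and y: "y \<in> K" "y \<notin> H"
    and g: "g \<in> carrier G" "\<And>h. h \<in> H \<Longrightarrow> commutator G g h \<in> N" "commutator G g y \<in> N"
    and k: "k \<in> K"
  shows "commutator G g k \<in> N"
proof -
  have sN: "subgroup N G" using N by (rule normal_imp_subgroup)
  have KG: "K \<subseteq> carrier G" using K by (rule subgroup.subset)
  have "H \<subseteq> mod_centralizer N g"
    using g idx(2) KG commutator_mem_sym[OF sN g(1)] unfolding mod_centralizer_def by blast
  moreover have "y \<in> mod_centralizer N g"
    using g y KG commutator_mem_sym[OF sN g(1)] unfolding mod_centralizer_def by blast
  ultimately have "K \<subseteq> mod_centralizer N g"
    using subset_subgroup_of_index_p[OF H K subgroup_mod_centralizer[OF N g(1)] idx _ y(1) _ y(2)]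
    by blast
  then show ?thesis
    using k KG commutator_mem_sym[OF sN _ g(1)] unfolding mod_centralizer_def by blast
qed

text \<open>If \<open>\<gamma> 2\<close> had index \<open>p\<close>, then \<open>G\<close> would be generated by \<open>\<gamma> 2\<close> and one further element,
  hence abelian modulo \<open>\<gamma> 3\<close>.\<close>

lemma card_gamma_2_less: "p * card (\<gamma> 2) < card (carrier G)"
proof (rule ccontr)
  assume "\<not> p * card (\<gamma> 2) < card (carrier G)"
  then have idx: "card (carrier G) \<le> p * card (\<gamma> 2)" by simp
  have "\<gamma> 2 \<subset> carrier G" using gamma_Suc_psubset[of 1] m_ge_4 by (simp add: numeral_2_eq_2)
  then obtain y where y: "y \<in> carrier G" "y \<notin> \<gamma> 2" by blast
  have sub: "\<gamma> 2 \<subseteq> carrier G" using \<open>\<gamma> 2 \<subset> carrier G\<close> by blast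
  note gen = commutator_mod_generation[OF normal_lower_central subgroup_lower_central subgroup_self idx sub y]
  have 2: "commutator G g h \<in> \<gamma> 3" if "h \<in> \<gamma> 2" "g \<in> carrier G" for g h
    using commutator_mem_lower_central'[OF _ that] by (simp add: eval_nat_numeral)
  have yy: "commutator G y y \<in> \<gamma> 3"
    using self_mem_mod_centralizer[OF subgroup_lower_central y(1)] unfolding mod_centralizer_def by blast
  \<comment> \<open>First pass with \<open>y\<close> on the left, where [y, y] is trivial; swapping
    the arguments then feeds a second pass with arbitrary \<open>g\<close>.\<close>
  have 3: "commutator G g y \<in> \<gamma> 3" if "g \<in> carrier G" for g
    using gen[OF y(1) 2[OF _ y(1)] yy that] commutator_mem_sym[OF subgroup_lower_central y(1) that] by blast
  have "commutator G g k \<in> \<gamma> 3" if "g \<in> carrier G" "k \<in> carrier G" for g k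
    using gen[OF that(1) 2[OF _ that(1)] 3[OF that(1)] that(2)] .
  then have "\<gamma> 2 \<subseteq> \<gamma> 3"
    using lower_central_Suc_subset_iff[of 1 "\<gamma> 3", OF _ subgroup_lower_central]
    by (simp add: numeral_2_eq_2)
  then show False using not_gamma_Suc_superset[of 2] m_ge_4 by (simp add: eval_nat_numeral)
qed

text \<open>The bound on \<open>\<gamma> 2\<close> propagates down the series and meets the lower
  bound of \<open>card_gamma_ge\<close>. The formula starts at 2, since G itself has order p^m and
  not p^(m - 1).\<close>

lemma card_gamma:
  assumes "2 \<le> i" "i \<le> m"
  shows "card (\<gamma> i) = p ^ (m - i)"
proof -
  have "card (\<gamma> i) \<le> p ^ (m - i)"
    using assms
  proof (induction i rule: nat_induct_at_least)
    case base
    have "card (\<gamma> 2) dvd p ^ m"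
      using lagrange[OF subgroup_lower_central] order_p by (metis dvd_triv_right)
    then obtain k where k: "card (\<gamma> 2) = p ^ k"
      using divides_primepow_nat[OF prime_p] by blast
    then have "p ^ Suc k < p ^ m"
      using card_gamma_2_less order_p by (simp add: order_def)
    then have "Suc k < m" using p_gt_1 power_less_imp_less_exp by blast
    then have "k \<le> m - 2" by simp
    then show ?case using k p_gt_1 by (simp add: power_increasing)
  next
    case (Suc i)
    then have "p * card (\<gamma> (Suc i)) \<le> p ^ (m - i)"
      using card_psubset_subgroup[OF subgroup_lower_central subgroup_lower_central gamma_Suc_psubset, of i]
      by simp
    moreover have "p ^ (m - i) = p * p ^ (m - Suc i)"
      using Suc by (simp add: Suc_diff_Suc flip: power_Suc)
    ultimately show ?case using p_gt_1 by simp
  qed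
  then show ?thesis using card_gamma_ge[of i] assms by simp
qed

lemma card_gamma_le_mult:
  assumes "2 \<le> i" "i < m"
  shows "card (\<gamma> i) \<le> p * card (\<gamma> (Suc i))"
proof -
  have "m - i = Suc (m - Suc i)" using assms by simp
  then show ?thesis using card_gamma[of i] card_gamma[of "Suc i"] assms by simp
qed

text \<open>\<open>\<gamma> i\<close> has order p over \<open>\<gamma> (Suc i)\<close>, and brackets
  with the latter fall into \<open>\<gamma> (i + 2)\<close>, so one element \<open>x\<close> tests
  the whole term. In particular the two-step centralizer is a subgroup.\<close>

lemma two_step_centralizer_eq:
  assumes i: "2 \<le> i" "i + 2 \<le> m" and x: "x \<in> \<gamma> i" "x \<notin> \<gamma> (Suc i)"
  shows "two_step_centralizer G i = mod_centralizer (\<gamma> (i + 2)) x"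
proof
  show "two_step_centralizer G i \<subseteq> mod_centralizer (\<gamma> (i + 2)) x"
    using x unfolding two_step_centralizer_def mod_centralizer_def by blast
next
  have "commutator G g h \<in> \<gamma> (i + 2)" if "g \<in> carrier G" "h \<in> \<gamma> (Suc i)" for g h
    using commutator_mem_lower_central'[OF _ that(2,1)] by simp
  then have "commutator G g k \<in> \<gamma> (i + 2)"
    if "g \<in> carrier G" "commutator G g x \<in> \<gamma> (i + 2)" "k \<in> \<gamma> i" for g k
    using commutator_mod_generation[OF normal_lower_central subgroup_lower_central
        subgroup_lower_central card_gamma_le_mult lower_central_Suc_subset x that(1) _ that(2,3)] i that
    by simp
  then show "mod_centralizer (\<gamma> (i + 2)) x \<subseteq> two_step_centralizer G i"
    unfolding two_step_centralizer_def mod_centralizer_def by blast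
qed

lemma ex_gamma_diff:
  assumes "1 \<le> i" "i < m"
  obtains x where "x \<in> \<gamma> i" "x \<notin> \<gamma> (Suc i)"
  using gamma_Suc_psubset[OF assms] by blast

section \<open>The series \<open>P\<close> and its maximal subgroup \<open>P 1\<close>\<close>

lemma P_1: "P 1 = two_step_centralizer G 2"
  by (simp add: P_series_def)

lemma P_eq_gamma: "2 \<le> i \<Longrightarrow> i \<le> m \<Longrightarrow> P i = \<gamma> i"
  using gamma_m by (auto simp: P_series_def)

lemma P_eq_one: "m \<le> i \<Longrightarrow> P i = {\<one>}"
  using m_ge_4 by (simp add: P_series_def)

lemma subgroup_P_1: "subgroup (P 1) G"
proof -
  obtain x where x: "x \<in> \<gamma> 2" "x \<notin> \<gamma> (Suc 2)"
    using ex_gamma_diff[of 2] m_ge_4 by auto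
  show ?thesis
    unfolding P_1
    using two_step_centralizer_eq[OF _ _ x] m_ge_4
      subgroup_mod_centralizer[OF normal_lower_central mem_lower_central_carrier[OF x(1)]]
    by simp
qed

text \<open>Otherwise \<open>\<gamma> 3\<close> would lie in \<open>\<gamma> 4\<close>, against
  \<open>m \<ge> 4\<close>.\<close>

lemma P_1_neq_carrier: "P 1 \<noteq> carrier G"
proof
  assume "P 1 = carrier G"
  then have "\<forall>x \<in> \<gamma> 2. \<forall>g \<in> carrier G. commutator G g x \<in> \<gamma> (2 + 2)"
    unfolding P_1 two_step_centralizer_def by blast
  then have "\<gamma> 3 \<subseteq> \<gamma> 4"
    using lower_central_Suc_subset_iff[of 2 "\<gamma> 4", OF _ subgroup_lower_central] by simp
  then show False
    using not_gamma_Suc_superset[of 3] m_ge_4 by simp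
qed

text \<open>For \<open>x\<close> in \<open>\<gamma> 2 - \<gamma> 3\<close>, the map \<open>g \<mapsto> [g, x]\<close> embeds \<open>G / P 1\<close> into \<open>\<gamma> 3 / \<gamma> 4\<close>.\<close>

lemma card_carrier_le_P_1: "card (carrier G) \<le> p * card (P 1)"
proof -
  obtain x where x: "x \<in> \<gamma> 2" "x \<notin> \<gamma> (Suc 2)"
    using ex_gamma_diff[of 2] m_ge_4 by auto
  have xG: "x \<in> carrier G" using mem_lower_central_carrier[OF x(1)] .
  let ?R = "rcosets\<^bsub>G\<lparr>carrier := \<gamma> 3\<rparr>\<^esub> (\<gamma> 4)"
  let ?N = "\<gamma> 4"
  have N: "?N \<lhd> G" and sN: "subgroup ?N G"
    by (rule normal_lower_central, rule subgroup_lower_central)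
  have 34: "\<gamma> 4 \<subseteq> \<gamma> 3" by (rule lower_central_antimono) simp
  have P1: "P 1 = mod_centralizer ?N x"
    unfolding P_1 using two_step_centralizer_eq[OF _ _ x] m_ge_4 by simp
  have x3: "commutator G g x \<in> \<gamma> 3" if "g \<in> carrier G" for g
    using commutator_mem_lower_central'[OF _ x(1) that] by (simp add: eval_nat_numeral)
  have x4: "commutator G g y \<in> ?N" if "g \<in> carrier G" "y \<in> \<gamma> 3" for g y
    using commutator_mem_lower_central'[OF _ that(2,1)] by (simp add: eval_nat_numeral)
  have cR: "card ?R = p"
  proof -
    have "card ?R * p ^ (m - 4) = p ^ (m - 3)"
      using card_subgroup_mult[OF sN subgroup_lower_central 34] card_gamma[of 3] card_gamma[of 4] m_ge_4
      by simp
    moreover have "m - 3 = Suc (m - 4)" using m_ge_4 by simp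
    ultimately show ?thesis using p_gt_1 by simp
  qed
  have "card (carrier G) \<le> card ?R * card (P 1)"
  proof (rule card_subgroup_le_fibres[OF subgroup_self])
    \<comment> \<open>Inverses appear because the fibres are measured by a b^-1: equal images will
      put b a^-1, hence its inverse, into \<open>P 1\<close>.\<close>
    show "(\<lambda>g. ?N #> commutator G (inv g) x) ` carrier G \<subseteq> ?R"
    proof (rule image_subsetI)
      fix g assume "g \<in> carrier G"
      then have "commutator G (inv g) x \<in> \<gamma> 3" using x3 by simp
      then show "?N #> commutator G (inv g) x \<in> ?R"
        by (auto simp: RCOSETS_def r_coset_def)
    qed
    show "finite ?R" using cR p_gt_1 by (metis card.infinite not_one_less_zero)
    show "finite (P 1)" using finite_subgroup[OF subgroup_P_1] .
    fix a b assume ab: "a \<in> carrier G" "b \<in> carrier G"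
      "?N #> commutator G (inv a) x = ?N #> commutator G (inv b) x"
    then have "commutator G (inv a) x \<otimes> inv (commutator G (inv b) x) \<in> ?N"
      using xG sN subgroup.rcos_module[OF sN is_group]
      by (metis commutator_closed inv_closed rcos_self)
    \<comment> \<open>Conjugation by \<open>b\<close> turns [a^-1, x] [b^-1, x]^-1 into the single
      commutator [b a^-1, x].\<close>
    then have "b \<otimes> (commutator G (inv a) x \<otimes> inv (commutator G (inv b) x)) \<otimes> inv b \<in> ?N"
      using normal.inv_op_closed2[OF N ab(2)] by blast
    also have "b \<otimes> (commutator G (inv a) x \<otimes> inv (commutator G (inv b) x)) \<otimes> inv b
        = commutator G (b \<otimes> inv a) x"
      using ab(1,2) xG by (simp add: commutator_def inv_mult_group m_assoc inv_mult_cancel_left)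
    finally have "b \<otimes> inv a \<in> P 1"
      using ab(1,2) unfolding P1 mod_centralizer_def by simp
    then have "inv (b \<otimes> inv a) \<in> P 1"
      by (rule subgroup.m_inv_closed[OF subgroup_P_1])
    then show "a \<otimes> inv b \<in> P 1"
      using ab(1,2) by (simp add: inv_mult_group)
  qed
  then show ?thesis using cR by simp
qed

lemma card_P_1: "card (P 1) = p ^ (m - 1)"
proof -
  have "P 1 \<subset> carrier G"
    using subgroup.subset[OF subgroup_P_1] P_1_neq_carrier by blast
  then have "p * card (P 1) \<le> card (carrier G)"
    by (rule card_psubset_subgroup[OF subgroup_P_1 subgroup_self])
  then have "p * card (P 1) = card (carrier G)"
    using card_carrier_le_P_1 by (rule le_antisym)
  also have "\<dots> = p * p ^ (m - 1)"
    using order_p m_ge_4 unfolding order_def by (simp flip: power_Suc)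
  finally show ?thesis using p_gt_1 by (subst (asm) mult_cancel1) auto
qed

lemma maximal_P_1: "maximal_subgroup (P 1) G"
proof -
  have "K = P 1 \<or> K = carrier G" if K: "subgroup K G" "P 1 \<subseteq> K" for K
  proof (rule disjCI)
    assume "K \<noteq> carrier G"
    show "K = P 1"
    proof (rule ccontr)
      assume "K \<noteq> P 1"
      then obtain x where x: "x \<in> K" "x \<notin> P 1" using K by blast
      have "x \<in> carrier G" using subgroup.mem_carrier[OF K(1) x(1)] .
      then have "carrier G \<subseteq> K"
        using subset_subgroup_of_index_p[OF subgroup_P_1 subgroup_self K(1) card_carrier_le_P_1 _ K(2)]
          x subgroup.subset[OF subgroup_P_1] by blast
      then show False
        using \<open>K \<noteq> carrier G\<close> subgroup.subset[OF K(1)] by blast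
    qed
  qed
  then show ?thesis
    unfolding maximal_subgroup_def using subgroup_P_1 P_1_neq_carrier by blast
qed

lemma subgroup_P: "subgroup (P i) G"
proof (cases "i = 1")
  case False
  then show ?thesis
    by (simp add: P_series_def subgroup_self subgroup_lower_central triv_subgroup)
qed (use subgroup_P_1 in simp)

text \<open>[\<gamma> 2, \<gamma> 2] falls into \<open>\<gamma> 4\<close>.\<close>

lemma gamma_2_subset_P_1: "\<gamma> 2 \<subseteq> P 1"
proof
  fix x assume x: "x \<in> \<gamma> 2"
  then have "commutator G x y \<in> \<gamma> (2 + 2)" if "y \<in> \<gamma> 2" for y
    using lower_central_commutator[OF _ _ x that] by simp
  then show "x \<in> P 1"
    unfolding P_1 two_step_centralizer_def using mem_lower_central_carrier[OF x] by blast
qed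

lemma P_antimono:
  assumes "i \<le> j"
  shows "P j \<subseteq> P i"
proof (rule lift_Suc_antimono_le[OF _ assms])
  fix i
  consider "i = 0" | "i = 1" | "2 \<le> i" "i < m" | "m \<le> i" by linarith
  then show "P (Suc i) \<subseteq> P i"
  proof cases
    case 1
    then show ?thesis using subgroup.subset[OF subgroup_P_1] by (simp add: P_series_def)
  next
    case 2
    then show ?thesis
      using gamma_2_subset_P_1 P_eq_gamma[of 2] m_ge_4 by (simp add: numeral_2_eq_2)
  next
    case 3
    then show ?thesis using lower_central_Suc_subset P_eq_gamma by simp
  next
    case 4
    then show ?thesis by (simp add: P_eq_one)
  qed
qed

text \<open>Each \<open>P i\<close> before index \<open>m\<close> lies in \<open>\<gamma> i\<close>.
  This makes 0 an admissible degree, so the maximum is taken over a nonempty set.\<close>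

lemma P_commutator:
  assumes i: "1 \<le> i" and j: "1 \<le> j" and a: "a \<in> P i" and b: "b \<in> P j"
  shows "commutator G a b \<in> P (i + j)"
proof (cases "m \<le> i \<or> m \<le> j")
  case True
  have "a \<in> carrier G" "b \<in> carrier G" using a b subgroup.mem_carrier[OF subgroup_P] by auto
  with True a b have "commutator G a b = \<one>" by (auto simp: P_eq_one commutator_eq_one_iff)
  then show ?thesis using subgroup.one_closed[OF subgroup_P] by simp
next
  case False
  have ag: "a \<in> \<gamma> i" if "i < m"
    using a i that subgroup.mem_carrier[OF subgroup_P a] by (cases "i = 1") (auto simp: P_series_def)
  have bg: "b \<in> \<gamma> j" if "j < m"
    using b j that subgroup.mem_carrier[OF subgroup_P b] by (cases "j = 1") (auto simp: P_series_def)
  have *: "commutator G a b \<in> \<gamma> (i + j)"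
    using lower_central_commutator[OF i j ag bg] False by auto
  show ?thesis
  proof (cases "i + j \<le> m")
    case True
    then show ?thesis using * P_eq_gamma[of "i + j"] i j by simp
  next
    case ge: False
    have "\<gamma> (i + j) \<subseteq> \<gamma> m" using ge by (intro lower_central_antimono) simp
    then have "commutator G a b = \<one>" using * gamma_m by blast
    then show ?thesis using subgroup.one_closed[OF subgroup_P] by simp
  qed
qed

end

subsection \<open>Centralizers for positive degree of commutativity\<close>

locale positive_degree_maximal_class = maximal_class +
  assumes pos_degree: "0 < degree_of_commutativity G m"
begin

text \<open>A positive degree gains one more step than \<open>P_commutator\<close>; if
  \<open>P 1\<close> is abelian the commutator is trivial anyway.\<close>

lemma P_1_commutator:
  assumes j: "1 \<le> j" and a: "a \<in> P 1" and b: "b \<in> P j"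
  shows "commutator G a b \<in> P (Suc (Suc j))"
proof (cases "commutative_subgroup (P 1) G")
  case True
  have "b \<in> P 1" using b P_antimono[OF j] by blast
  then have "commutator G a b = \<one>"
    using True a commutative_subgroup_iff[OF subgroup_P] by blast
  then show ?thesis using subgroup.one_closed[OF subgroup_P] by simp
next
  case False
  let ?Q = "\<lambda>l. \<forall>i\<ge>1. \<forall>j\<ge>1. commutator_subgroup G (P i) (P j) \<subseteq> P (i + j + l)"
  have "?Q 0"
    using P_commutator by (intro allI impI commutator_subgroup_subset subgroup_P) auto
  \<comment> \<open>\<open>GREATEST\<close> is attained only over a bounded set: an \<open>l\<close>
    beyond \<open>m\<close> would send [P 1, P 1] into the trivial terms, making \<open>P 1\<close>
    abelian.\<close>
  moreover have "l \<le> m" if "?Q l" for l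
  proof (rule ccontr)
    assume "\<not> l \<le> m"
    have "commutator G x y \<in> P (1 + 1 + l)" if "x \<in> P 1" "y \<in> P 1" for x y
      using \<open>?Q l\<close> commutator_mem_commutator_subgroup[OF that] by blast
    then have "commutative_subgroup (P 1) G"
      using \<open>\<not> l \<le> m\<close> by (simp add: commutative_subgroup_iff[OF subgroup_P] P_eq_one)
    then show False using False by blast
  qed
  ultimately have "?Q (GREATEST l. ?Q l)"
    by (intro GreatestI_nat[of ?Q 0 m])
  moreover have deg: "degree_of_commutativity G m = (GREATEST l. ?Q l)"
    using False unfolding degree_of_commutativity_def by simp
  ultimately have "?Q (degree_of_commutativity G m)" by simp
  then have "commutator G a b \<in> P (1 + j + degree_of_commutativity G m)"
    using commutator_mem_commutator_subgroup[OF a b] j by blast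
  then show ?thesis
    using P_antimono[of "Suc (Suc j)" "1 + j + degree_of_commutativity G m"] pos_degree by auto
qed

lemma card_P:
  assumes "1 \<le> i" "i \<le> m"
  shows "card (P i) = p ^ (m - i)"
proof (cases "i = 1")
  case True
  then show ?thesis using card_P_1 by simp
next
  case False
  then show ?thesis using assms card_gamma[of i] P_eq_gamma[of i] by simp
qed

lemma card_P_le_mult:
  assumes "1 \<le> i" "i < m"
  shows "card (P i) \<le> p * card (P (Suc i))"
proof -
  have "m - i = Suc (m - Suc i)" using assms by simp
  then show ?thesis using card_P[of i] card_P[of "Suc i"] assms by simp
qed

lemma P_Suc_neq:
  assumes "1 \<le> i" "i < m"
  shows "P i \<noteq> P (Suc i)"
proof
  assume eq: "P i = P (Suc i)"
  have "m - i = Suc (m - Suc i)" using assms by simp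
  then show False using eq card_P[of i] card_P[of "Suc i"] assms p_gt_1 by simp
qed

lemma not_mem_P_1_generates:
  assumes "subgroup L G" "P 1 \<subseteq> L" "s \<in> L" "s \<notin> P 1"
  shows "L = carrier G"
  using maximal_P_1 assms unfolding maximal_subgroup_def by blast

text \<open>Bracketing with an element outside \<open>P 1\<close> moves down the series by exactly one step:
  otherwise \<open>G\<close>, generated by \<open>P 1\<close> and \<open>s\<close>, would centralize \<open>P i / P (i + 2)\<close>.\<close>

lemma commutator_not_mem_P:
  assumes i: "1 \<le> i" "i + 2 \<le> m" and s: "s \<in> carrier G" "s \<notin> P 1"
    and x: "x \<in> P i" "x \<notin> P (Suc i)"
  shows "commutator G s x \<notin> P (i + 2)"
proof
  assume sx: "commutator G s x \<in> P (i + 2)"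
  let ?N = "\<gamma> (i + 2)"
  have NP: "P (i + 2) = ?N" using P_eq_gamma[of "i + 2"] i by simp
  have N: "?N \<lhd> G" and sN: "subgroup ?N G"
    by (rule normal_lower_central, rule subgroup_lower_central)
  have xG: "x \<in> carrier G" using subgroup.mem_carrier[OF subgroup_P x(1)] .
  \<comment> \<open>\<open>P 1\<close> centralizes \<open>x\<close> modulo \<open>?N\<close> by the
    positive degree and \<open>s\<close> does by assumption, so by maximality of \<open>P 1\<close>
    all of G does.\<close>
  have "P 1 \<subseteq> mod_centralizer ?N x"
    using P_1_commutator[OF i(1) _ x(1)] NP subgroup.mem_carrier[OF subgroup_P_1]
    by (auto simp: mod_centralizer_def)
  moreover have "s \<in> mod_centralizer ?N x"
    using sx s NP by (simp add: mod_centralizer_def)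
  ultimately have A: "mod_centralizer ?N x = carrier G"
    using not_mem_P_1_generates subgroup_mod_centralizer[OF N xG] s by blast
  have gP: "commutator G g h \<in> ?N" if "g \<in> carrier G" "h \<in> P (Suc i)" for g h
    using commutator_mem_lower_central'[of "Suc i" h g] that P_eq_gamma[of "Suc i"] i by simp
  have le: "card (P i) \<le> p * card (P (Suc i))" using card_P_le_mult i by simp
  have B: "commutator G g k \<in> ?N" if "g \<in> carrier G" "k \<in> P i" for g k
    using commutator_mod_generation[OF N subgroup_P subgroup_P le P_antimono x that(1) gP[OF that(1)] _ that(2)]
      A that(1) by (auto simp: mod_centralizer_def)
  \<comment> \<open>For i \<ge> 2, \<open>P i\<close> is \<open>\<gamma> i\<close> and the lower
    central series would stall. For i = 1, \<open>P 1\<close> is smaller than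
    \<open>\<gamma> 1\<close>, and \<open>s\<close> has to be added to make G abelian modulo
    \<open>\<gamma> 3\<close>.\<close>
  show False
  proof (cases "i = 1")
    case False
    then have "\<gamma> (Suc i) \<subseteq> ?N"
      using lower_central_Suc_subset_iff[OF i(1) sN] B P_eq_gamma[of i] i by simp
    then show False using not_gamma_Suc_superset[of "Suc i"] i by simp
  next
    case True
    note gen = commutator_mod_generation[OF N subgroup_P_1 subgroup_self card_carrier_le_P_1
        subgroup.subset[OF subgroup_P_1] s]
    have ss: "commutator G s s \<in> ?N"
      using self_mem_mod_centralizer[OF sN s(1)] by (simp add: mod_centralizer_def)
    have P1: "commutator G g k \<in> ?N" if "g \<in> carrier G" "k \<in> P 1" for g k
      using B that True by simp
    have "commutator G s k \<in> ?N" if "k \<in> carrier G" for k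
      using gen[OF s(1) P1[OF s(1)] ss that] .
    then have gs: "commutator G g s \<in> ?N" if "g \<in> carrier G" for g
      using commutator_mem_sym[OF sN s(1) that] that by blast
    have "commutator G g k \<in> ?N" if "g \<in> carrier G" "k \<in> carrier G" for g k
      using gen[OF that(1) P1[OF that(1)] gs[OF that(1)] that(2)] .
    then have "\<gamma> (Suc 1) \<subseteq> ?N"
      using lower_central_Suc_subset_iff[of 1, OF _ sN] by simp
    then show False using not_gamma_Suc_superset[of "Suc 1"] i True by (simp add: eval_nat_numeral)
  qed
qed

text \<open>An element of \<open>P 1\<close> outside \<open>P (m - 1)\<close> drops out of the
  series at some index, where \<open>commutator_not_mem_P\<close> forbids it to commute with
  \<open>s\<close>. Conversely \<open>P (m - 1)\<close> is central since \<open>\<gamma> m\<close>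
  is trivial.\<close>

lemma mod_one_centralizer_Int_P_1:
  assumes s: "s \<in> carrier G" "s \<notin> P 1"
  shows "mod_centralizer {\<one>} s \<inter> P 1 = P (m - 1)"
proof
  show "mod_centralizer {\<one>} s \<inter> P 1 \<subseteq> P (m - 1)"
  proof (rule subsetI, rule ccontr)
    fix y assume y: "y \<in> mod_centralizer {\<one>} s \<inter> P 1" and n: "y \<notin> P (m - 1)"
    \<comment> \<open>\<open>j\<close> is the first index whose term misses \<open>y\<close>; it is
      at least 2 and at most m - 1, so \<open>j - 1\<close> is admissible in
      \<open>commutator_not_mem_P\<close>.\<close>
    define j where "j = (LEAST j. y \<notin> P j)"
    have yj: "y \<notin> P j" unfolding j_def using n by (rule LeastI)
    have jm: "j \<le> m - 1" unfolding j_def using n by (rule Least_le)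
    have "y \<in> P 0" using y subgroup.mem_carrier[OF subgroup_P_1] by (simp add: P_series_def)
    then have "j \<noteq> 0" "j \<noteq> 1" using yj y by (metis, metis IntD2)
    then obtain i where i: "j = Suc i" "1 \<le> i" by (cases j) auto
    have "y \<in> P i" using not_less_Least[of i "\<lambda>j. y \<notin> P j"] i unfolding j_def by simp
    moreover have "commutator G s y = \<one>"
      using y s commutator_mem_sym[OF triv_subgroup, of y s] by (auto simp: mod_centralizer_def)
    ultimately show False
      using commutator_not_mem_P[OF i(2) _ s, of y] yj i jm m_ge_4
        subgroup.one_closed[OF subgroup_P, of "i + 2"]
      by simp
  qed
next
  have "commutator G y s = \<one>" if "y \<in> P (m - 1)" for y
    using commutator_mem_lower_central[of "m - 1" y s] that s gamma_m P_eq_gamma[of "m - 1"] m_ge_4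
    by simp
  moreover have "P (m - 1) \<subseteq> P 1" using m_ge_4 by (intro P_antimono) simp
  ultimately show "P (m - 1) \<subseteq> mod_centralizer {\<one>} s \<inter> P 1"
    using subgroup.mem_carrier[OF subgroup_P_1] unfolding mod_centralizer_def by blast
qed

lemma subgroup_centralizer: "x \<in> carrier G \<Longrightarrow> subgroup (mod_centralizer {\<one>} x) G"
  by (rule subgroup_mod_centralizer[OF one_is_normal])

lemma card_rcosets_P_1: "card (rcosets (P 1)) = p"
proof -
  have "card (rcosets (P 1)) * p ^ (m - 1) = p * p ^ (m - 1)"
    using lagrange[OF subgroup_P_1] card_P_1 order_p m_ge_4 by (simp flip: power_Suc)
  then show ?thesis using p_gt_1 by simp
qed

text \<open>|C(s)| is at most |G : P 1| |C(s) \<inter> P 1| = p p. It is at least p^2 because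
  \<open>s\<close> lies in C(s) but not in \<open>P (m - 1)\<close>.\<close>

lemma card_centralizer_outside_P_1:
  assumes s: "s \<in> carrier G" "s \<notin> P 1"
  shows "card (mod_centralizer {\<one>} s) = p ^ 2"
proof (rule antisym)
  let ?C = "mod_centralizer {\<one>} s"
  have c: "card (P (m - 1)) = p" using card_P[of "m - 1"] m_ge_4 by simp
  have "card ?C \<le> card (rcosets (P 1)) * card (?C \<inter> P 1)"
    by (rule card_subgroup_le_Int[OF subgroup_centralizer[OF s(1)] subgroup_P_1 finite_G])
  then show "card ?C \<le> p ^ 2"
    unfolding mod_one_centralizer_Int_P_1[OF s] c card_rcosets_P_1 by (simp add: power2_eq_square)
  have "s \<in> ?C" by (rule self_mem_mod_centralizer[OF triv_subgroup s(1)])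
  then have "P (m - 1) \<subset> ?C"
    using mod_one_centralizer_Int_P_1[OF s] s(2) by blast
  then show "p ^ 2 \<le> card ?C"
    using card_psubset_subgroup[OF subgroup_P subgroup_centralizer[OF s(1)], of "m - 1"] c
    by (simp add: power2_eq_square)
qed

lemma centralizer_central:
  assumes "x \<in> P (m - 1)"
  shows "mod_centralizer {\<one>} x = carrier G"
proof -
  have "commutator G g x = \<one>" if "g \<in> carrier G" for g
    using commutator_mem_lower_central'[of "m - 1" x g] that assms gamma_m P_eq_gamma[of "m - 1"] m_ge_4
    by simp
  then show ?thesis unfolding mod_centralizer_def by blast
qed

text \<open>By symmetry of commuting, an \<open>s\<close> outside \<open>P 1\<close> centralizing
  \<open>x\<close> would force \<open>x\<close> into \<open>P (m - 1)\<close>.\<close>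

lemma centralizer_subset_P_1:
  assumes "x \<in> P 1" "x \<notin> P (m - 1)"
  shows "mod_centralizer {\<one>} x \<subseteq> P 1"
proof
  fix s assume s: "s \<in> mod_centralizer {\<one>} x"
  then have sG: "s \<in> carrier G" by (simp add: mod_centralizer_def)
  have "x \<in> mod_centralizer {\<one>} s"
    using mem_mod_centralizer_sym[OF triv_subgroup, of x s] s sG
      subgroup.mem_carrier[OF subgroup_P_1 assms(1)] by blast
  then show "s \<in> P 1" using mod_one_centralizer_Int_P_1[OF sG] assms by blast
qed

text \<open>For \<open>a\<close> in \<open>A\<close> outside \<open>P 1\<close>, the elements
  commuting with \<open>a\<close> modulo \<open>\<gamma> 3\<close> form a subgroup containing
  \<open>A\<close>, hence equal to \<open>A\<close> or G. Both cases fail, so A \<subseteq> P 1,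
  with equality by maximality.\<close>

lemma abelian_maximal_eq_P_1:
  assumes A: "maximal_subgroup A G" "commutative_subgroup A G"
  shows "A = P 1"
proof -
  have sA: "subgroup A G" using A(1) by (simp add: maximal_subgroup_def)
  have max: "K = A \<or> K = carrier G" if "subgroup K G" "A \<subseteq> K" for K
    using A(1) that by (simp add: maximal_subgroup_def)
  have comm: "commutator G x y = \<one>" if "x \<in> A" "y \<in> A" for x y
    using A(2) that commutative_subgroup_iff[OF sA] by blast
  have AG: "x \<in> A \<Longrightarrow> x \<in> carrier G" for x using subgroup.mem_carrier[OF sA] .
  have "A \<subseteq> P 1"
  proof (rule subsetI, rule ccontr)
    fix a assume a: "a \<in> A" "a \<notin> P 1"
    let ?K = "mod_centralizer (\<gamma> 3) a"
    have "A \<subseteq> ?K"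
      using comm a AG subgroup.one_closed[OF subgroup_lower_central] by (auto simp: mod_centralizer_def)
    then consider "?K = A" | "?K = carrier G"
      using max subgroup_mod_centralizer[OF normal_lower_central AG[OF a(1)]] by blast
    then show False
    proof cases
      case 1
      \<comment> \<open>\<open>\<gamma> 2\<close> commutes with \<open>a\<close> modulo
        \<open>\<gamma> 3\<close>, so it lies in \<open>A\<close> and truly commutes with
        \<open>a\<close>. This traps it in \<open>P (m - 1)\<close> and so in
        \<open>\<gamma> 3\<close>.\<close>
      have "\<gamma> 2 \<subseteq> ?K"
        using commutator_mem_lower_central[of 2 _ a] AG[OF a(1)] mem_lower_central_carrier[of _ 2]
        by (auto simp: mod_centralizer_def)
      then have "\<gamma> 2 \<subseteq> mod_centralizer {\<one>} a"
        using 1 comm a AG by (auto simp: mod_centralizer_def)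
      then have "\<gamma> 2 \<subseteq> P (m - 1)"
        using mod_one_centralizer_Int_P_1[OF AG[OF a(1)] a(2)] gamma_2_subset_P_1 by blast
      also have "P (m - 1) \<subseteq> P 3" using m_ge_4 by (intro P_antimono) simp
      also have "P 3 = \<gamma> 3" using P_eq_gamma[of 3] m_ge_4 by simp
      finally show False using not_gamma_Suc_superset[of 2] m_ge_4 by simp
    next
      case 2
      \<comment> \<open>Now \<open>a\<close> is central modulo \<open>\<gamma> 3\<close>, yet
        bracketing it with \<open>P 1\<close> outside \<open>P 2\<close> must not reach
        \<open>P 3\<close>.\<close>
      have "P 2 \<subset> P 1" using P_Suc_neq[of 1] P_antimono[of 1 2] m_ge_4 by (auto simp: numeral_2_eq_2)
      then obtain x where x: "x \<in> P 1" "x \<notin> P (Suc 1)" by (auto simp: numeral_2_eq_2)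
      have xG: "x \<in> carrier G" using subgroup.mem_carrier[OF subgroup_P_1 x(1)] .
      then have "commutator G x a \<in> \<gamma> 3" using 2 by (auto simp: mod_centralizer_def)
      then have "commutator G a x \<in> P 3"
        using commutator_mem_sym[OF subgroup_lower_central xG AG[OF a(1)]] P_eq_gamma[of 3] m_ge_4 by simp
      then show False
        using commutator_not_mem_P[OF _ _ AG[OF a(1)] a(2) x] m_ge_4 by (simp add: eval_nat_numeral)
    qed
  qed
  then show ?thesis
    using max[OF subgroup_P_1] P_1_neq_carrier by blast
qed

lemma card_centralizer_eq_P_1:
  assumes x: "x \<in> P 1" "x \<notin> P (m - 1)" and "\<And>y. y \<in> P 1 \<Longrightarrow> commutator G y x = \<one>"
  shows "card (mod_centralizer {\<one>} x) = p ^ (m - 1)"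
proof -
  have "P 1 \<subseteq> mod_centralizer {\<one>} x"
    using assms(3) subgroup.mem_carrier[OF subgroup_P_1] by (auto simp: mod_centralizer_def)
  then have "mod_centralizer {\<one>} x = P 1" using centralizer_subset_P_1[OF x] by blast
  then show ?thesis using card_P_1 by simp
qed

text \<open>An element of \<open>P 1\<close> centralizing \<open>P 1\<close> but outside \<open>P 3\<close> would generate, with \<open>P 3\<close>,
  a central subgroup of index at most \<open>p\<close> in \<open>P 1\<close>, so \<open>P 1\<close> would be abelian.\<close>

lemma card_centralizer_outside_P_3:
  assumes P13: "\<And>u v. u \<in> P 1 \<Longrightarrow> v \<in> P 3 \<Longrightarrow> commutator G u v = \<one>"
    and nab: "\<not> commutative_subgroup (P 1) G"
    and x: "x \<in> P 1" "x \<notin> P 3"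
  shows "card (mod_centralizer {\<one>} x) = p ^ (m - 2)"
proof -
  let ?C = "mod_centralizer {\<one>} x"
  have xG: "x \<in> carrier G" using subgroup.mem_carrier[OF subgroup_P_1 x(1)] .
  have sC: "subgroup ?C G" by (rule subgroup_centralizer[OF xG])
  have "P (m - 1) \<subseteq> P 3" using m_ge_4 by (intro P_antimono) simp
  then have xm: "x \<notin> P (m - 1)" using x by blast
  have C1: "?C \<subseteq> P 1" by (rule centralizer_subset_P_1[OF x(1) xm])
  have "P 3 \<subseteq> P 1" by (rule P_antimono) simp
  have P3G: "v \<in> P 3 \<Longrightarrow> v \<in> carrier G" for v using subgroup.mem_carrier[OF subgroup_P] .
  have "P 3 \<subseteq> ?C"
    using P13[OF x(1)] commutator_mem_sym[OF triv_subgroup xG] P3G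
    by (auto simp: mod_centralizer_def)
  moreover have "x \<in> ?C" by (rule self_mem_mod_centralizer[OF triv_subgroup xG])
  ultimately have "P 3 \<subset> ?C" using x by blast
  \<comment> \<open>\<open>P 3\<close> has index p^2 in \<open>P 1\<close>, so two strict inclusions
    with \<open>?C\<close> in between determine its order.\<close>
  from card_psubset_subgroup[OF subgroup_P sC this]
  have lower: "p * p ^ (m - 3) \<le> card ?C" using card_P[of 3] m_ge_4 by simp
  have "Suc (m - 3) = m - 2" "Suc (m - 2) = m - 1" using m_ge_4 by simp_all
  then have e: "p * p ^ (m - 3) = p ^ (m - 2)" "p * p ^ (m - 2) = p ^ (m - 1)"
    by (metis power_Suc)+
  have "?C \<noteq> P 1"
  proof
    assume C: "?C = P 1"
    have "commutator G u v = \<one>" if u: "u \<in> P 1" and v: "v \<in> P 1" for u v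
    proof -
      let ?D = "mod_centralizer {\<one>} u"
      have uG: "u \<in> carrier G" using subgroup.mem_carrier[OF subgroup_P_1 u] .
      have D3: "P 3 \<subseteq> ?D"
        using P13[OF u] commutator_mem_sym[OF triv_subgroup uG] P3G
        by (auto simp: mod_centralizer_def)
      have xD: "x \<in> ?D"
        using C u mem_mod_centralizer_sym[OF triv_subgroup xG uG] by blast
      have uD: "u \<in> ?D" by (rule self_mem_mod_centralizer[OF triv_subgroup uG])
      have "P 1 \<subseteq> ?D"
      proof (rule ccontr)
        assume n: "\<not> P 1 \<subseteq> ?D"
        then have D: "subgroup (?D \<inter> P 1) G" "?D \<inter> P 1 \<subset> P 1"
          using subgroups_Inter_pair[OF subgroup_centralizer[OF uG] subgroup_P_1] by auto
        have "p * card (?D \<inter> P 1) \<le> p ^ (m - 1)"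
          using card_psubset_subgroup[OF D(1) subgroup_P_1 D(2)] card_P_1 by simp
        then have c: "card (?D \<inter> P 1) \<le> p ^ (m - 2)"
          using p_gt_1 unfolding e(2)[symmetric] by simp
        \<comment> \<open>The order bound makes C(u) \<inter> P 1 generated by \<open>P 3\<close>
          and \<open>x\<close>, which all of \<open>P 1\<close> centralizes. So \<open>u\<close>,
          lying in it, commutes with \<open>P 1\<close>, a contradiction.\<close>
        have "?D \<inter> P 1 \<subseteq> mod_centralizer {\<one>} w" if "w \<in> P 1" for w
        proof (rule subset_subgroup_of_index_p[OF subgroup_P D(1) _ _ _ _ _ _ x(2)])
          have wG: "w \<in> carrier G" using subgroup.mem_carrier[OF subgroup_P_1 that] .
          show "subgroup (mod_centralizer {\<one>} w) G" by (rule subgroup_centralizer[OF wG])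
          show "card (?D \<inter> P 1) \<le> p * card (P 3)"
            using c card_P[of 3] m_ge_4 e by simp
          show "P 3 \<subseteq> ?D \<inter> P 1" using D3 \<open>P 3 \<subseteq> P 1\<close> by blast
          show "P 3 \<subseteq> mod_centralizer {\<one>} w"
            using P13[OF that] commutator_mem_sym[OF triv_subgroup wG] P3G
            by (auto simp: mod_centralizer_def)
          show "x \<in> ?D \<inter> P 1" using xD x by blast
          show "x \<in> mod_centralizer {\<one>} w"
            using C that mem_mod_centralizer_sym[OF triv_subgroup xG wG] by blast
        qed
        then have "u \<in> mod_centralizer {\<one>} w" if "w \<in> P 1" for w
          using uD u that by blast
        then have "P 1 \<subseteq> ?D"
          using mem_mod_centralizer_sym[OF triv_subgroup uG] subgroup.mem_carrier[OF subgroup_P_1]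
          by blast
        with n show False by blast
      qed
      then show ?thesis
        using v commutator_mem_sym[OF triv_subgroup _ uG, of v] unfolding mod_centralizer_def by blast
    qed
    then show False using nab commutative_subgroup_iff[OF subgroup_P_1] by blast
  qed
  then have "p * card ?C \<le> p ^ (m - 1)"
    using card_psubset_subgroup[OF sC subgroup_P_1] C1 card_P_1 by auto
  then have "card ?C \<le> p ^ (m - 2)"
    using p_gt_1 unfolding e(2)[symmetric] by simp
  then show ?thesis using lower unfolding e by simp
qed

section \<open>Summing over the centralizers\<close>

lemma sum_centralizers_const:
  assumes "B \<subseteq> A" "finite A" "\<And>g. g \<in> A - B \<Longrightarrow> card (mod_centralizer {\<one>} g) = c"
    and "card A = a" "card B = b"
  shows "(\<Sum>g \<in> A - B. 1 / (1 - of_nat (card (mod_centralizer {\<one>} g)) * fps_X))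
    = (of_nat a - of_nat b) / (1 - of_nat c * fps_X :: rat fps)"
proof -
  have "(\<Sum>g \<in> A - B. 1 / (1 - of_nat (card (mod_centralizer {\<one>} g)) * fps_X))
      = (\<Sum>g \<in> A - B. 1 / (1 - of_nat c * fps_X) :: rat fps)"
    using assms(3) by (intro sum.cong) auto
  also have "\<dots> = of_nat (a - b) * (1 / (1 - of_nat c * fps_X))"
    using assms by (simp add: card_Diff_subset finite_subset)
  \<comment> \<open>The truncated difference is a true one because
    \<open>B \<subseteq> A\<close>.\<close>
  also have "\<dots> = (of_nat a - of_nat b) / (1 - of_nat c * fps_X)"
    using card_mono[OF assms(2,1)] assms(4,5) by (simp add: of_nat_diff fps_divide_unit)
  finally show ?thesis .
qed

lemma P_chain: "P (m - 1) \<subseteq> P 3" "P 3 \<subseteq> P 1" "P 1 \<subseteq> carrier G"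
  using m_ge_4 subgroup.subset[OF subgroup_P_1] by (auto intro!: P_antimono)

lemma sum_centralizers_center:
  "(\<Sum>g \<in> P (m - 1). 1 / (1 - of_nat (card (mod_centralizer {\<one>} g)) * fps_X))
    = of_nat p / (1 - of_nat p ^ m * fps_X :: rat fps)"
  using sum_centralizers_const[of "{}" "P (m - 1)" "p ^ m" p 0] centralizer_central order_p
    card_P[of "m - 1"] m_ge_4 finite_subgroup[OF subgroup_P]
  by (simp add: order_def)

lemma sum_centralizers_outside_P_1:
  "(\<Sum>g \<in> carrier G - P 1. 1 / (1 - of_nat (card (mod_centralizer {\<one>} g)) * fps_X))
    = (of_nat p ^ m - of_nat p ^ (m - 1)) / (1 - of_nat p ^ 2 * fps_X :: rat fps)"
  using sum_centralizers_const[OF P_chain(3) finite_G card_centralizer_outside_P_1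
      order_p[unfolded order_def] card_P_1] by simp

text \<open>Both cases of the theorem share the contributions of the center and of the complement of
  \<open>P 1\<close>; only the middle layer remains.\<close>

lemma conj_orbit_series_split:
  "conj_orbit_series G = 1 / of_nat p ^ m *
    (of_nat p / (1 - of_nat p ^ m * fps_X)
     + (of_nat p ^ m - of_nat p ^ (m - 1)) / (1 - of_nat p ^ 2 * fps_X)
     + (\<Sum>g \<in> P 1 - P (m - 1). 1 / (1 - of_nat (card (mod_centralizer {\<one>} g)) * fps_X)))"
proof -
  let ?f = "\<lambda>g. 1 / (1 - of_nat (card (mod_centralizer {\<one>} g)) * fps_X :: rat fps)"
  have "sum ?f (carrier G) = sum ?f (carrier G - P 1) + sum ?f (P 1)"
    by (rule sum.subset_diff[OF P_chain(3) finite_G])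
  also have "sum ?f (P 1) = sum ?f (P 1 - P (m - 1)) + sum ?f (P (m - 1))"
    using P_chain by (intro sum.subset_diff finite_subgroup subgroup_P_1) auto
  finally show ?thesis
    unfolding conj_orbit_series_eq_sum[OF finite_G] order_p sum_centralizers_center
      sum_centralizers_outside_P_1
    by (simp add: ac_simps)
qed

lemma conj_orbit_series_abelian:
  assumes "commutative_subgroup (P 1) G"
  shows "conj_orbit_series G = 1 / of_nat p ^ m *
    (of_nat p / (1 - of_nat p ^ m * fps_X)
     + (of_nat p ^ m - of_nat p ^ (m - 1)) / (1 - of_nat p ^ 2 * fps_X)
     + (of_nat p ^ (m - 1) - of_nat p) / (1 - of_nat p ^ (m - 1) * fps_X))"
proof -
  have "card (mod_centralizer {\<one>} g) = p ^ (m - 1)" if "g \<in> P 1 - P (m - 1)" for g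
    using that assms commutative_subgroup_iff[OF subgroup_P_1]
    by (intro card_centralizer_eq_P_1) auto
  from sum_centralizers_const[OF _ finite_subgroup[OF subgroup_P_1] this card_P_1, of "P (m - 1)"]
  show ?thesis
    unfolding conj_orbit_series_split using P_chain card_P[of "m - 1"] m_ge_4 by auto
qed

text \<open>The middle layer is cut at \<open>P 3\<close>, whose elements are centralized by
  \<open>P 1\<close>. For m = 4 the inner piece is empty and its numerator vanishes.\<close>

lemma conj_orbit_series_nonabelian:
  assumes P13: "commutator_subgroup G (P 1) (P 3) = {\<one>}"
    and nab: "\<not> commutative_subgroup (P 1) G"
  shows "conj_orbit_series G = 1 / of_nat p ^ m *
    (of_nat p / (1 - of_nat p ^ m * fps_X)
     + (of_nat p ^ m - of_nat p ^ (m - 1)) / (1 - of_nat p ^ 2 * fps_X)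
     + (of_nat p ^ (m - 1) - of_nat p ^ (m - 3)) / (1 - of_nat p ^ (m - 2) * fps_X)
     + (of_nat p ^ (m - 3) - of_nat p) / (1 - of_nat p ^ (m - 1) * fps_X))"
proof -
  let ?f = "\<lambda>g. 1 / (1 - of_nat (card (mod_centralizer {\<one>} g)) * fps_X :: rat fps)"
  have comm: "commutator G u v = \<one>" if "u \<in> P 1" "v \<in> P 3" for u v
    using commutator_mem_commutator_subgroup[OF that] P13 by simp
  have c1: "card (P (m - 1)) = p" using card_P[of "m - 1"] m_ge_4 by simp
  have c3: "card (P 3) = p ^ (m - 3)" using card_P[of 3] m_ge_4 by simp
  have "card (mod_centralizer {\<one>} g) = p ^ (m - 2)" if "g \<in> P 1 - P 3" for g
    using that comm nab by (intro card_centralizer_outside_P_3) auto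
  from sum_centralizers_const[OF P_chain(2) finite_subgroup[OF subgroup_P_1] this card_P_1 c3]
  have A: "sum ?f (P 1 - P 3)
      = (of_nat p ^ (m - 1) - of_nat p ^ (m - 3)) / (1 - of_nat p ^ (m - 2) * fps_X)"
    by simp
  have "card (mod_centralizer {\<one>} g) = p ^ (m - 1)" if "g \<in> P 3 - P (m - 1)" for g
    using that comm P_chain by (intro card_centralizer_eq_P_1) auto
  from sum_centralizers_const[OF P_chain(1) finite_subgroup[OF subgroup_P] this c3 c1]
  have B: "sum ?f (P 3 - P (m - 1))
      = (of_nat p ^ (m - 3) - of_nat p) / (1 - of_nat p ^ (m - 1) * fps_X)"
    by simp
  have "sum ?f (P 1 - P (m - 1)) = sum ?f (P 1 - P 3) + sum ?f (P 3 - P (m - 1))"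
    using P_chain finite_subgroup[OF subgroup_P_1]
    by (subst sum.union_disjoint[symmetric]) (auto intro!: sum.cong intro: finite_subset)
  then show ?thesis
    unfolding conj_orbit_series_split A B by (simp add: add.assoc)
qed

end

theorem theorem4p2:
  fixes G :: "('a, 'b) monoid_scheme" and p m :: nat
  assumes "Factorial_Ring.prime p"
    and "maximal_class_group G p m"
    and "degree_of_commutativity G m > 0"
  shows "((\<exists>H. maximal_subgroup H G \<and> commutative_subgroup H G) \<longrightarrow>
            conj_orbit_series G =
              1 / of_nat p ^ m *
              (of_nat p / (1 - of_nat p ^ m * fps_X)
               + (of_nat p ^ m - of_nat p ^ (m - 1)) / (1 - of_nat p ^ 2 * fps_X)
               + (of_nat p ^ (m - 1) - of_nat p) / (1 - of_nat p ^ (m - 1) * fps_X)))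
       \<and> (commutator_subgroup G (P_series G m 1) (P_series G m 3) = {\<one>\<^bsub>G\<^esub>} \<and>
           \<not> (\<exists>H. maximal_subgroup H G \<and> commutative_subgroup H G) \<longrightarrow>
            conj_orbit_series G =
              1 / of_nat p ^ m *
              (of_nat p / (1 - of_nat p ^ m * fps_X)
               + (of_nat p ^ m - of_nat p ^ (m - 1)) / (1 - of_nat p ^ 2 * fps_X)
               + (of_nat p ^ (m - 1) - of_nat p ^ (m - 3)) / (1 - of_nat p ^ (m - 2) * fps_X)
               + (of_nat p ^ (m - 3) - of_nat p) / (1 - of_nat p ^ (m - 1) * fps_X)))"
proof -
  interpret group G using assms(2) by (simp add: maximal_class_group_def)
  interpret positive_degree_maximal_class G p m
    using assms by unfold_locales (auto simp: maximal_class_group_def)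
  \<comment> \<open>\<open>P 1\<close> is maximal and the only possible abelian maximal subgroup, so
    one exists exactly when \<open>P 1\<close> is abelian.\<close>
  show ?thesis
    using conj_orbit_series_abelian conj_orbit_series_nonabelian abelian_maximal_eq_P_1 maximal_P_1
    by blast
qed

end
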